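(* Let $k\ge0$, $m\ge 2$ and $1\le\ell\le m-1$ be integers and let $P_{k,\ell}(\underline x)$ be an $\mathbb R_{0,m}^{(\ell)}$-valued polynomial belonging to $\mathsf M_l(k)$. Let $F=AP_{k,\ell}+B\underline xP_{k,\ell}+CP_{k,\ell}\underline x+D\underline x P_{k,\ell}\underline x$ be an axial two-sided monogenic function defined in an open neighbourhood of $$\Omega=\left\{(x_0,\underline x)\in\mathbb R^{m+1}:\;(x_0,r)\in [a_1,b_1]\times[a_2,b_2]\subset\mathbb R^2\right\},\quad r=|\underline x|,\quad a_2>0.$$ Then there exists an axial left monogenic function $\left(M(x_0,r)+\dfrac{\underline x}{r}\,N(x_0,r)\right)P_{k,\ell}(\underline x)$ such that $$F(x_0,\underline x)-\left[\left(M(x_0,r)+\frac{\underline x}{r}\,N(x_0,r)\right)P_{k,\ell}(\underline x)\right](\partial_{x_0}-\partial_{\underline x})=c\,P_{k,\ell}(\underline x)$$ on $\Omega$, where $c$ is a real constant.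
   Context: $\mathbb R_{0,m}$ is the real Clifford algebra generated by the canonical basis $e_1,\dots,e_m$ of $\mathbb R^m$ with $e_je_k+e_ke_j=-2\delta_{jk}$. For $A=\{j_1<\dots<j_s\}\subset\{1,\dots,m\}$ put $e_A=e_{j_1}\cdots e_{j_s}$, $e_\emptyset=1$, and $\mathbb R_{0,m}^{(\ell)}=\mathrm{span}_{\mathbb R}(e_A:|A|=\ell)$ ($\ell$-vectors). Points of $\mathbb R^m$ are identified with $\underline x=\sum_{j=1}^m x_je_j$; points of $\mathbb R^{m+1}$ are written $(x_0,\underline x)$. The Dirac operator is $\partial_{\underline x}=\sum_{j=1}^me_j\partial_{x_j}$, acting from the left by $\partial_{\underline x}f=\sum_je_j\,\partial_{x_j}f$ and from the right by $f\partial_{\underline x}=\sum_j(\partial_{x_j}f)\,e_j$; thus $f(\partial_{x_0}-\partial_{\underline x})=\partial_{x_0}f-f\partial_{\underline x}$. A continuously differentiable $\mathbb R_{0,m}$-valued function $f$ is left (resp. right) monogenic if $\partial_{x_0}f+\partial_{\underline x}f=0$ (resp. $\partial_{x_0}f+f\partial_{\underline x}=0$), and two-sided monogenic if it is both. $\mathsf M_l(k)$ is the set of homogeneous polynomials $P$ of degree $k$ in $\mathbb R^m$ with $\partial_{\underline x}P=0$. An axial left monogenic function is a left monogenic function of the form $\left(M(x_0,r)+\frac{\underline x}{r}N(x_0,r)\right)P_k(\underline x)$ with $r=|\underline x|$, $M,N$ real-valued continuously differentiable functions of $(x_0,r)$ and $P_k\in\mathsf M_l(k)$. An axial two-sided monogenic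 function is a two-sided monogenic function of the form $A(x_0,r)P_{k,\ell}(\underline x)+B(x_0,r)\underline xP_{k,\ell}(\underline x)+C(x_0,r)P_{k,\ell}(\underline x)\underline x+D(x_0,r)\underline x P_{k,\ell}(\underline x)\underline x$, where $r=|\underline x|$, $P_{k,\ell}$ is an $\mathbb R_{0,m}^{(\ell)}$-valued polynomial in $\mathsf M_l(k)$ with $1\le\ell\le m-1$, and $A,B,C,D$ are real-valued continuously differentiable functions in some open subset of $\mathbb R^2_+=\{(x_1,x_2)\in\mathbb R^2: x_2>0\}$. *)

theory Defs
  imports "HOL-Analysis.Analysis"
begin

section \<open>The Clifford algebra \<open>R\<^sub>0\<^sub>,\<^sub>m\<close>\<close>

text \<open>
  The finite linearly ordered type \<open>'m\<close> plays the role of \<open>{1,\<dots>,m}\<close>, so \<open>m = CARD('m)\<close>, and a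
  Clifford number is the vector of its coordinates with respect to the basis \<open>(e\<^sub>A)\<close>.
  The constants \<open>1\<close> and \<open>(*)\<close> of the type \<open>vec\<close> are componentwise and are not
  the unit and the product of the algebra.
\<close>

type_synonym 'm euclid = "(real, 'm) vec"
type_synonym 'm clifford = "(real, 'm set) vec"

definition cbase :: "'m::{finite,linorder} set \<Rightarrow> 'm clifford" where
  "cbase A = axis A 1"

abbreviation cunit :: "'m::{finite,linorder} clifford" where
  "cunit \<equiv> cbase {}"

abbreviation cgen :: "'m::{finite,linorder} \<Rightarrow> 'm clifford" where
  "cgen j \<equiv> cbase {j}"

text \<open>
  Sorting \<open>e\<^sub>A e\<^sub>B\<close> costs a factor \<open>-1\<close> for each pair \<open>(i, j) \<in> A \<times> B\<close> with \<open>j < i\<close> (a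
  transposition) and for each pair with \<open>i = j\<close> (as \<open>e\<^sub>j e\<^sub>j = -1\<close>); what remains is indexed by
  the symmetric difference of \<open>A\<close> and \<open>B\<close>.
\<close>

definition csign :: "'m::{finite,linorder} set \<Rightarrow> 'm set \<Rightarrow> real" where
  "csign A B = (-1) ^ card {(i, j). i \<in> A \<and> j \<in> B \<and> j \<le> i}"

definition cmul :: "'m::{finite,linorder} clifford \<Rightarrow> 'm clifford \<Rightarrow> 'm clifford"
    (infixl "\<odot>" 70) where
  "a \<odot> b = (\<Sum>A\<in>UNIV. \<Sum>B\<in>UNIV. (a $ A * b $ B * csign A B) *\<^sub>R cbase ((A - B) \<union> (B - A)))"

definition cvec :: "'m::{finite,linorder} euclid \<Rightarrow> 'm clifford" where
  "cvec x = (\<Sum>j\<in>UNIV. (x $ j) *\<^sub>R cgen j)"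

definition multivectors :: "nat \<Rightarrow> 'm::{finite,linorder} clifford set" where
  "multivectors l = span {cbase A | A. card A = l}"


text \<open>The product is bilinear, associative and unital, the generators satisfy the defining
  relations, and \<open>e\<^sub>A\<close> is the product of its generators in increasing order.\<close>

lemma bounded_bilinear_cmul: "bounded_bilinear (cmul :: 'm::{finite,linorder} clifford \<Rightarrow> _)"
proof -
  have "bilinear (cmul :: 'm clifford \<Rightarrow> _)"
    unfolding bilinear_def
    by (auto intro!: linearI
        simp: cmul_def algebra_simps sum.distrib scaleR_sum_right)
  then show ?thesis
    by (simp add: bilinear_conv_bounded_bilinear)
qed

lemma cmul_cbase:
  "cbase A \<odot> cbase B = csign A B *\<^sub>R cbase ((A - B) \<union> (B - A))"
proof -
  have "cbase A \<odot> cbase B =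
     (\<Sum>A'\<in>UNIV. \<Sum>B'\<in>UNIV. if A' = A \<and> B' = B then csign A B *\<^sub>R cbase ((A - B) \<union> (B - A)) else 0)"
    unfolding cmul_def by (intro sum.cong refl) (auto simp: cbase_def axis_def)
  also have "\<dots> = (\<Sum>A'\<in>UNIV. if A' = A then csign A B *\<^sub>R cbase ((A - B) \<union> (B - A)) else 0)"
    by (intro sum.cong refl) auto
  finally show ?thesis by simp
qed

lemma clifford_eq_sum_cbase: "a = (\<Sum>A\<in>UNIV. (a $ A) *\<^sub>R cbase A)"
  by (simp add: vec_eq_iff cbase_def axis_def if_distrib cong: if_cong)

lemma csign_eq_prod: "csign A B = (\<Prod>i\<in>A. \<Prod>j\<in>B. if j \<le> i then -1 else 1)"
proof -
  have "(\<Prod>i\<in>A. \<Prod>j\<in>B. if j \<le> i then -1 else 1)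
      = (\<Prod>p\<in>A \<times> B. if snd p \<le> fst p then - 1 else (1::real))"
    by (simp add: prod.cartesian_product case_prod_beta)
  also have "\<dots> = (\<Prod>p\<in>{p \<in> A \<times> B. snd p \<le> fst p}. -1)"
    by (rule prod.inter_filter [symmetric]) simp
  also have "\<dots> = (-1) ^ card {p \<in> A \<times> B. snd p \<le> fst p}"
    by simp
  also have "{p \<in> A \<times> B. snd p \<le> fst p} = {(i, j). i \<in> A \<and> j \<in> B \<and> j \<le> i}"
    by auto
  finally show ?thesis by (simp add: csign_def)
qed

lemma prod_symdiff:
  fixes f :: "'a::finite \<Rightarrow> real"
  assumes "\<And>i. f i * f i = 1"
  shows "prod f ((A - B) \<union> (B - A)) = prod f A * prod f B"
proof -
  have "prod f ((A - B) \<union> (B - A)) = prod f (A - B) * prod f (B - A)"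
    by (rule prod.union_disjoint) auto
  moreover have "prod f A = prod f (A - B) * prod f (A \<inter> B)"
    by (subst prod.union_disjoint [symmetric]) (auto intro!: arg_cong[of _ _ "prod f"])
  moreover have "prod f B = prod f (B - A) * prod f (A \<inter> B)"
    by (subst prod.union_disjoint [symmetric]) (auto intro!: arg_cong[of _ _ "prod f"])
  moreover have "prod f (A \<inter> B) * prod f (A \<inter> B) = 1"
    by (simp add: prod.distrib [symmetric] assms)
  ultimately show ?thesis
    by (metis (no_types, lifting) mult.assoc mult.commute mult.right_neutral)
qed

lemma csign_symdiff_left: "csign ((A - B) \<union> (B - A)) C = csign A C * csign B C"
  unfolding csign_eq_prod
  by (rule prod_symdiff) (auto simp flip: prod.distrib intro!: prod.neutral)

lemma csign_symdiff_right: "csign A ((B - C) \<union> (C - B)) = csign A B * csign A C"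
  unfolding csign_eq_prod
  by (simp add: prod.distrib [symmetric]) (intro prod.cong refl prod_symdiff, simp)

lemma cmul_assoc: "(a \<odot> b) \<odot> c = a \<odot> (b \<odot> c)"
proof -
  interpret bounded_bilinear "cmul :: 'a clifford \<Rightarrow> _" by (rule bounded_bilinear_cmul)
  have sym: "((A - B) \<union> (B - A)) - C \<union> (C - ((A - B) \<union> (B - A)))
      = (A - ((B - C) \<union> (C - B))) \<union> (((B - C) \<union> (C - B)) - A)" for A B C :: "'a set"
    by blast
  have base: "(cbase A \<odot> cbase B) \<odot> cbase C = cbase A \<odot> (cbase B \<odot> cbase C)" for A B C :: "'a set"
    by (simp add: cmul_cbase scaleR_left scaleR_right csign_symdiff_left csign_symdiff_right sym)
  let ?s = "\<lambda>a. \<Sum>A\<in>UNIV. (a $ A) *\<^sub>R cbase A"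
  have "(?s a \<odot> ?s b) \<odot> ?s c = ?s a \<odot> (?s b \<odot> ?s c)"
    by (simp add: sum_left sum_right scaleR_left scaleR_right base scaleR_sum_right mult_ac)
  then show ?thesis
    by (simp only: clifford_eq_sum_cbase [symmetric])
qed

lemma cunit_cmul: "cunit \<odot> a = a" and cmul_cunit: "a \<odot> cunit = a"
proof -
  interpret bounded_bilinear "cmul :: 'a clifford \<Rightarrow> _" by (rule bounded_bilinear_cmul)
  let ?s = "\<Sum>A\<in>UNIV. (a $ A) *\<^sub>R cbase A"
  have "cunit \<odot> ?s = ?s" "?s \<odot> cunit = ?s"
    by (simp_all add: sum_left sum_right scaleR_left scaleR_right cmul_cbase csign_def)
  then show "cunit \<odot> a = a" "a \<odot> cunit = a"
    by (simp_all only: clifford_eq_sum_cbase [symmetric])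
qed

lemma cgen_anticommute:
  "cgen j \<odot> cgen k + cgen k \<odot> cgen j = (if j = k then - 2 else 0) *\<^sub>R cunit"
proof (cases "j = k")
  case True
  then show ?thesis
    by (simp add: cmul_cbase csign_eq_prod scaleR_2 algebra_simps)
next
  case False
  then have "({j} - {k}) \<union> ({k} - {j}) = {j, k}" "({k} - {j}) \<union> ({j} - {k}) = {j, k}"
    by auto
  with False show ?thesis
    by (auto simp add: cmul_cbase csign_eq_prod)
qed

lemma cbase_eq_product:
  "cbase A = foldr (\<lambda>j a. cgen j \<odot> a) (sorted_list_of_set A) cunit"
proof -
  have "sorted js \<Longrightarrow> distinct js \<Longrightarrow> cbase (set js) = foldr (\<lambda>j a. cgen j \<odot> a) js cunit" for js :: "'a list"
  proof (induction js)
    case (Cons j js)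
    then have less: "\<And>i. i \<in> set js \<Longrightarrow> \<not> i \<le> j"
      by force
    then have "csign {j} (set js) = 1"
      by (simp add: csign_eq_prod)
    moreover have "({j} - set js) \<union> (set js - {j}) = insert j (set js)"
      using less by auto
    ultimately have "cgen j \<odot> cbase (set js) = cbase (insert j (set js))"
      by (simp only: cmul_cbase scaleR_one)
    then show ?case using Cons by simp
  qed simp
  from this [of "sorted_list_of_set A"] show ?thesis by simp
qed


section \<open>Monogenic functions\<close>

definition C1_on :: "'a::real_normed_vector set \<Rightarrow> ('a \<Rightarrow> 'b::real_normed_vector) \<Rightarrow> bool" where
  "C1_on S f \<longleftrightarrow> (\<exists>f'. (\<forall>x\<in>S. (f has_derivative blinfun_apply (f' x)) (at x)) \<and> continuous_on S f')"

definition pderiv_at :: "'m::finite \<Rightarrow> ('m euclid \<Rightarrow> 'b::real_normed_vector) \<Rightarrow> 'm euclid \<Rightarrow> 'b" where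
  "pderiv_at j f x = vector_derivative (\<lambda>t. f (x + t *\<^sub>R axis j 1)) (at 0)"

definition dirac_left ::
    "('m::{finite,linorder} euclid \<Rightarrow> 'm clifford) \<Rightarrow> 'm euclid \<Rightarrow> 'm clifford" where
  "dirac_left f x = (\<Sum>j\<in>UNIV. cgen j \<odot> pderiv_at j f x)"

definition dirac_right ::
    "('m::{finite,linorder} euclid \<Rightarrow> 'm clifford) \<Rightarrow> 'm euclid \<Rightarrow> 'm clifford" where
  "dirac_right f x = (\<Sum>j\<in>UNIV. pderiv_at j f x \<odot> cgen j)"

text \<open>Points of \<open>\<real>\<^sup>m\<^sup>+\<^sup>1\<close> are pairs \<open>(x0, x)\<close>; the Dirac operators act on the variable \<open>x\<close>.\<close>

definition dx0 :: "(real \<times> 'm::finite euclid \<Rightarrow> 'b::real_normed_vector) \<Rightarrow> real \<times> 'm euclid \<Rightarrow> 'b" where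
  "dx0 f = (\<lambda>(x0, x). vector_derivative (\<lambda>t. f (t, x)) (at x0))"

definition left_monogenic_on ::
    "(real \<times> 'm::{finite,linorder} euclid) set \<Rightarrow> (real \<times> 'm euclid \<Rightarrow> 'm clifford) \<Rightarrow> bool" where
  "left_monogenic_on V f \<longleftrightarrow> C1_on V f \<and>
     (\<forall>(x0, x)\<in>V. dx0 f (x0, x) + dirac_left (\<lambda>y. f (x0, y)) x = 0)"

definition right_monogenic_on ::
    "(real \<times> 'm::{finite,linorder} euclid) set \<Rightarrow> (real \<times> 'm euclid \<Rightarrow> 'm clifford) \<Rightarrow> bool" where
  "right_monogenic_on V f \<longleftrightarrow> C1_on V f \<and>
     (\<forall>(x0, x)\<in>V. dx0 f (x0, x) + dirac_right (\<lambda>y. f (x0, y)) x = 0)"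

definition two_sided_monogenic_on ::
    "(real \<times> 'm::{finite,linorder} euclid) set \<Rightarrow> (real \<times> 'm euclid \<Rightarrow> 'm clifford) \<Rightarrow> bool" where
  "two_sided_monogenic_on V f \<longleftrightarrow> left_monogenic_on V f \<and> right_monogenic_on V f"

text \<open>\<open>f (\<partial>\<^sub>x\<^sub>0 - \<partial>\<^sub>x)\<close>, with the Dirac operator acting from the right.\<close>

definition conj_CR_right ::
    "(real \<times> 'm::{finite,linorder} euclid \<Rightarrow> 'm clifford) \<Rightarrow> real \<times> 'm euclid \<Rightarrow> 'm clifford" where
  "conj_CR_right f = (\<lambda>(x0, x). dx0 f (x0, x) - dirac_right (\<lambda>y. f (x0, y)) x)"

definition homogeneous_poly :: "nat \<Rightarrow> ('m::finite euclid \<Rightarrow> 'b::real_vector) \<Rightarrow> bool" where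
  "homogeneous_poly k P \<longleftrightarrow> (\<exists>c :: ('m \<Rightarrow> nat) \<Rightarrow> 'b.
     P = (\<lambda>x. \<Sum>\<alpha> | (\<Sum>j\<in>UNIV. \<alpha> j) = k. (\<Prod>j\<in>UNIV. x $ j ^ \<alpha> j) *\<^sub>R c \<alpha>))"

lemma finite_multi_indices: "finite {\<alpha> :: 'm::finite \<Rightarrow> nat. (\<Sum>j\<in>UNIV. \<alpha> j) = k}"
proof (rule finite_subset)
  show "{\<alpha> :: 'm \<Rightarrow> nat. (\<Sum>j\<in>UNIV. \<alpha> j) = k} \<subseteq> Pi\<^sub>E UNIV (\<lambda>_. {..k})"
    by (auto simp: PiE_iff intro: member_le_sum)
  show "finite (Pi\<^sub>E (UNIV :: 'm set) (\<lambda>_. {..k}))"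
    by (intro finite_PiE) auto
qed

text \<open>The set \<open>M\<^sub>l(k)\<close>; the zero polynomial belongs to it for every \<open>k\<close>.\<close>

definition left_monogenic_polys :: "nat \<Rightarrow> ('m::{finite,linorder} euclid \<Rightarrow> 'm clifford) set" where
  "left_monogenic_polys k = {P. homogeneous_poly k P \<and> (\<forall>x. dirac_left P x = 0)}"


section \<open>Axial monogenic functions\<close>

abbreviation upper_half_plane :: "(real \<times> real) set" where
  "upper_half_plane \<equiv> {(x1, x2). x2 > 0}"

definition axial_left ::
    "(real \<times> real \<Rightarrow> real) \<Rightarrow> (real \<times> real \<Rightarrow> real) \<Rightarrow>
     ('m::{finite,linorder} euclid \<Rightarrow> 'm clifford) \<Rightarrow> real \<times> 'm euclid \<Rightarrow> 'm clifford" where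
  "axial_left M N P = (\<lambda>(x0, x). let r = norm x in
     (M (x0, r) *\<^sub>R cunit + N (x0, r) *\<^sub>R cvec (x /\<^sub>R r)) \<odot> P x)"

definition axial_two_sided ::
    "(real \<times> real \<Rightarrow> real) \<Rightarrow> (real \<times> real \<Rightarrow> real) \<Rightarrow>
     (real \<times> real \<Rightarrow> real) \<Rightarrow> (real \<times> real \<Rightarrow> real) \<Rightarrow>
     ('m::{finite,linorder} euclid \<Rightarrow> 'm clifford) \<Rightarrow> real \<times> 'm euclid \<Rightarrow> 'm clifford" where
  "axial_two_sided A B C D P = (\<lambda>(x0, x). let r = norm x in
     A (x0, r) *\<^sub>R P x + B (x0, r) *\<^sub>R (cvec x \<odot> P x)
     + C (x0, r) *\<^sub>R (P x \<odot> cvec x) + D (x0, r) *\<^sub>R (cvec x \<odot> P x \<odot> cvec x))"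

text \<open>The coefficients are required to be \<open>C\<^sup>1\<close> on some open subset \<open>U\<close> of the half plane which
  contains \<open>(x0, |x|)\<close> for every point \<open>(x0, x)\<close> of the domain \<open>V\<close>.\<close>

definition axial_left_monogenic_on ::
    "(real \<times> 'm::{finite,linorder} euclid) set \<Rightarrow> nat \<Rightarrow>
     (real \<times> real \<Rightarrow> real) \<Rightarrow> (real \<times> real \<Rightarrow> real) \<Rightarrow>
     ('m euclid \<Rightarrow> 'm clifford) \<Rightarrow> bool" where
  "axial_left_monogenic_on V k M N P \<longleftrightarrow>
     P \<in> left_monogenic_polys k \<and>
     (\<exists>U. open U \<and> U \<subseteq> upper_half_plane \<and> (\<forall>(x0, x)\<in>V. (x0, norm x) \<in> U) \<and>
          C1_on U M \<and> C1_on U N) \<and>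
     left_monogenic_on V (axial_left M N P)"

definition axial_two_sided_monogenic_on ::
    "(real \<times> 'm::{finite,linorder} euclid) set \<Rightarrow> nat \<Rightarrow> nat \<Rightarrow>
     (real \<times> real \<Rightarrow> real) \<Rightarrow> (real \<times> real \<Rightarrow> real) \<Rightarrow>
     (real \<times> real \<Rightarrow> real) \<Rightarrow> (real \<times> real \<Rightarrow> real) \<Rightarrow>
     ('m euclid \<Rightarrow> 'm clifford) \<Rightarrow> bool" where
  "axial_two_sided_monogenic_on V k l A B C D P \<longleftrightarrow>
     1 \<le> l \<and> l \<le> CARD('m) - 1 \<and>
     P \<in> left_monogenic_polys k \<and> range P \<subseteq> multivectors l \<and>
     (\<exists>U. open U \<and> U \<subseteq> upper_half_plane \<and> (\<forall>(x0, x)\<in>V. (x0, norm x) \<in> U) \<and>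
          C1_on U A \<and> C1_on U B \<and> C1_on U C \<and> C1_on U D) \<and>
     two_sided_monogenic_on V (axial_two_sided A B C D P)"

definition axial_rectangle ::
    "real \<Rightarrow> real \<Rightarrow> real \<Rightarrow> real \<Rightarrow> (real \<times> 'm::finite euclid) set" where
  "axial_rectangle a1 b1 a2 b2 = {(x0, x). (x0, norm x) \<in> {a1..b1} \<times> {a2..b2}}"

end

(*
Write m = CARD('m), n = m + 2k, and s = (-1)^(l+1) (m - 2l), so that the sum of the e_j P e_j is s P.
The Dirac operator maps xP, Px, xPx to -n P, s P, -(n+2) Px - s xP, and reversal of products turns
this into the rules for the operator acting from the right. On each sphere |x| = r the functions
P, xP, Px, xPx are linearly independent: x -> -x separates {P, xPx} from {xP, Px}, and
applying the Dirac operator to a homogenised relation removes it because |s| < n. Comparing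
coefficients, two-sided monogenicity becomes
  B = C,   A_0 = r B_r + (n-s) B,   A_r = r (s D - B_0),   B_0 = r D_r + (n+2) D,   B_r = -r D_0,
where the indices 0 and r denote partial derivatives. With N = r H, the coefficients of the
required identity are then matched by
  dH = B dx_0 - r D dr,   dM = (-r^2 D + n H) dx_0 - r B dr.
Both forms are closed on a rectangle, hence exact, and the remaining coefficient
c = A + r^2 D - (n-s) H has zero gradient.
*)
theory Submission
  imports Defs
begin

section \<open>Continuously differentiable maps and closed forms\<close>

text \<open>The coefficients of \<open>xP\<close>, \<open>Px\<close>, \<open>xPx\<close> in the
  required identity prescribe \<open>H_0 = B\<close>, \<open>M_r = -r B\<close>,
  \<open>H_r = -r D\<close>, and left monogenicity of the function sought prescribes
  \<open>M_0 = r H_r + n H\<close>. Both gradients are thus prescribed, so the coefficient of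
  \<open>P\<close> can only be checked, and it turns out constant. Two points shape the argument.
  Comparing coefficients at one value of \<open>(x0, r)\<close> gives a relation on a single sphere,
  while the Dirac operator differentiates across spheres; homogeneity of \<open>P\<close> carries
  the relation to the whole space. And the given domain need not be invariant under rotations nor
  have a convex image in the half plane; compactness yields a slightly larger open rectangle over
  which all spheres lie in the domain, and its convexity supplies the primitives. Only first
  derivatives of \<open>A\<close>, \<open>B\<close>, \<open>C\<close>, \<open>D\<close> are
  available, which suffices because both forms have continuously differentiable coefficients. For
  \<open>P = 0\<close> no coefficients can be compared, and zero functions serve.\<close>

lemma C1_onI:
  fixes f :: "'a::euclidean_space \<Rightarrow> 'b::real_normed_vector"
  assumes "\<And>x. x \<in> S \<Longrightarrow> (f has_derivative f' x) (at x)"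
    and "\<And>h. continuous_on S (\<lambda>x. f' x h)"
  shows "C1_on S f"
  unfolding C1_on_def
proof (intro exI conjI ballI)
  \<comment> \<open>\<open>Blinfun\<close> is meaningful only on bounded linear maps, so
    \<open>F\<close> gets the default value 0 outside \<open>S\<close>, where nothing is known of
    \<open>f' x\<close>.\<close>
  define F where "F x = (if x \<in> S then Blinfun (f' x) else 0)" for x
  have F: "blinfun_apply (F x) = f' x" if "x \<in> S" for x
    using that assms(1)[OF that] by (simp add: F_def bounded_linear_Blinfun_apply has_derivative_bounded_linear)
  show "(f has_derivative blinfun_apply (F x)) (at x)" if "x \<in> S" for x
    using assms(1) F that by simp
  \<comment> \<open>On a finite-dimensional domain, an operator-valued map is continuous once its
    values at each fixed vector are.\<close>
  show "continuous_on S F"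
    using assms(2) by (intro continuous_on_blinfun_componentwise) (simp add: F cong: continuous_on_cong)
qed

lemma C1_onE:
  assumes "C1_on S f"
  obtains f' where "\<And>x. x \<in> S \<Longrightarrow> (f has_derivative f' x) (at x)"
    "\<And>h. continuous_on S (\<lambda>x. f' x h)"
proof -
  from assms obtain F where "\<And>x. x \<in> S \<Longrightarrow> (f has_derivative blinfun_apply (F x)) (at x)" "continuous_on S F"
    unfolding C1_on_def by blast
  then show ?thesis
    by (intro that[of "\<lambda>x. blinfun_apply (F x)"]) (auto intro!: continuous_intros)
qed

lemma C1_on_subset: "C1_on S f \<Longrightarrow> T \<subseteq> S \<Longrightarrow> C1_on T f"
  unfolding C1_on_def by (meson continuous_on_subset subsetD)

lemma C1_on_imp_continuous_on: "C1_on S f \<Longrightarrow> continuous_on S f"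
  by (erule C1_onE) (meson continuous_at_imp_continuous_on has_derivative_continuous)

lemma C1_on_const: "C1_on S (\<lambda>x::'a::euclidean_space. c)"
  by (rule C1_onI[where f' = "\<lambda>_ _. 0"]) (auto intro!: derivative_eq_intros)

lemma C1_on_bounded_linear:
  fixes f :: "'a::euclidean_space \<Rightarrow> 'b::real_normed_vector"
  assumes "bounded_linear f"
  shows "C1_on S f"
  by (rule C1_onI[where f' = "\<lambda>_. f"]) (auto intro!: bounded_linear_imp_has_derivative assms)

lemma C1_on_add:
  fixes f g :: "'a::euclidean_space \<Rightarrow> 'b::real_normed_vector"
  assumes "C1_on S f" "C1_on S g"
  shows "C1_on S (\<lambda>x. f x + g x)"
proof -
  obtain f' where f': "\<And>x. x \<in> S \<Longrightarrow> (f has_derivative f' x) (at x)"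
    "\<And>h. continuous_on S (\<lambda>x. f' x h)" by (rule C1_onE[OF assms(1)]) blast
  obtain g' where g': "\<And>x. x \<in> S \<Longrightarrow> (g has_derivative g' x) (at x)"
    "\<And>h. continuous_on S (\<lambda>x. g' x h)" by (rule C1_onE[OF assms(2)]) blast
  show ?thesis
    by (rule C1_onI[where f' = "\<lambda>x h. f' x h + g' x h"])
       (auto intro!: derivative_eq_intros continuous_intros f' g')
qed

lemma C1_on_sum:
  fixes f :: "'i \<Rightarrow> 'a::euclidean_space \<Rightarrow> 'b::real_normed_vector"
  assumes "\<And>i. i \<in> I \<Longrightarrow> C1_on S (f i)"
  shows "C1_on S (\<lambda>x. \<Sum>i\<in>I. f i x)"
  using assms by (induction I rule: infinite_finite_induct) (auto intro: C1_on_const C1_on_add)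

lemma (in bounded_bilinear) C1_on:
  fixes f :: "'d::euclidean_space \<Rightarrow> 'a"
  assumes "C1_on S f" "C1_on S g"
  shows "C1_on S (\<lambda>x. prod (f x) (g x))"
proof -
  obtain f' where f': "\<And>x. x \<in> S \<Longrightarrow> (f has_derivative f' x) (at x)"
    "\<And>h. continuous_on S (\<lambda>x. f' x h)" by (rule C1_onE[OF assms(1)]) blast
  obtain g' where g': "\<And>x. x \<in> S \<Longrightarrow> (g has_derivative g' x) (at x)"
    "\<And>h. continuous_on S (\<lambda>x. g' x h)" by (rule C1_onE[OF assms(2)]) blast
  show ?thesis
    by (rule C1_onI[where f' = "\<lambda>x h. prod (f x) (g' x h) + prod (f' x h) (g x)"])
       (intro FDERIV f' g', auto intro!: continuous_on_add continuous_on f' g' intro: C1_on_imp_continuous_on assms)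
qed

lemma C1_on_prod:
  fixes f :: "'i \<Rightarrow> 'a::euclidean_space \<Rightarrow> real"
  assumes "\<And>i. i \<in> I \<Longrightarrow> C1_on S (f i)"
  shows "C1_on S (\<lambda>x. \<Prod>i\<in>I. f i x)"
  using assms by (induction I rule: infinite_finite_induct)
    (auto intro: C1_on_const bounded_bilinear.C1_on[OF bounded_bilinear_mult])

lemma C1_on_power:
  fixes f :: "'a::euclidean_space \<Rightarrow> real"
  assumes "C1_on S f"
  shows "C1_on S (\<lambda>x. f x ^ n)"
  using assms by (induction n)
    (auto intro: C1_on_const bounded_bilinear.C1_on[OF bounded_bilinear_mult])

lemma C1_on_compose:
  fixes f :: "'a::euclidean_space \<Rightarrow> 'b::euclidean_space" and g :: "'b \<Rightarrow> 'c::real_normed_vector"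
  assumes "C1_on S f" "C1_on T g" "f ` S \<subseteq> T"
  shows "C1_on S (\<lambda>x. g (f x))"
proof -
  obtain f' where f': "\<And>x. x \<in> S \<Longrightarrow> (f has_derivative f' x) (at x)"
    "\<And>h. continuous_on S (\<lambda>x. f' x h)" by (rule C1_onE[OF assms(1)]) blast
  \<comment> \<open>The derivative of \<open>g\<close> is kept as a \<open>blinfun\<close>: it is
    applied to a vector that varies with \<open>x\<close>, which continuity at fixed vectors does
    not cover directly.\<close>
  obtain g' where g': "\<And>x. x \<in> T \<Longrightarrow> (g has_derivative blinfun_apply (g' x)) (at x)" "continuous_on T g'"
    using assms(2) unfolding C1_on_def by blast
  show ?thesis
  proof (rule C1_onI[where f' = "\<lambda>x h. blinfun_apply (g' (f x)) (f' x h)"])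
    show "((\<lambda>x. g (f x)) has_derivative (\<lambda>h. blinfun_apply (g' (f x)) (f' x h))) (at x)" if "x \<in> S" for x
      using has_derivative_compose[OF f'(1)[OF that] g'(1)] that assms(3) by blast
    show "continuous_on S (\<lambda>x. blinfun_apply (g' (f x)) (f' x h))" for h
      using assms(3)
      by (intro continuous_intros f' continuous_on_compose2[OF g'(2)] C1_on_imp_continuous_on[OF assms(1)]) auto
  qed
qed

lemma C1_on_norm:
  assumes "\<And>x. x \<in> S \<Longrightarrow> x \<noteq> 0"
  shows "C1_on S (norm :: 'a::euclidean_space \<Rightarrow> real)"
proof (rule C1_onI[where f' = "\<lambda>x h. x \<bullet> h / norm x"])
  show "(norm has_derivative (\<lambda>h. x \<bullet> h / norm x)) (at x)" if "x \<in> S" for x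
    using assms[OF that] has_derivative_norm[of x]
    by (simp add: sgn_div_norm divide_inverse mult.commute inner_commute)
  show "continuous_on S (\<lambda>x. x \<bullet> h / norm x)" for h
    using assms by (intro continuous_intros) auto
qed

lemma C1_on_Pair:
  fixes f :: "'a::euclidean_space \<Rightarrow> 'b::real_normed_vector" and g :: "'a \<Rightarrow> 'c::real_normed_vector"
  assumes "C1_on S f" "C1_on S g"
  shows "C1_on S (\<lambda>x. (f x, g x))"
proof -
  obtain f' where f': "\<And>x. x \<in> S \<Longrightarrow> (f has_derivative f' x) (at x)"
    "\<And>h. continuous_on S (\<lambda>x. f' x h)" by (rule C1_onE[OF assms(1)]) blast
  obtain g' where g': "\<And>x. x \<in> S \<Longrightarrow> (g has_derivative g' x) (at x)"
    "\<And>h. continuous_on S (\<lambda>x. g' x h)" by (rule C1_onE[OF assms(2)]) blast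
  show ?thesis
    by (rule C1_onI[where f' = "\<lambda>x h. (f' x h, g' x h)"])
       (auto intro!: has_derivative_Pair continuous_intros f' g')
qed

text \<open>A 1-form is represented by the vector field \<open>\<omega>\<close>; its primitive is the integral along the
  rays from a fixed point, differentiated under the integral sign.\<close>

lemma closed_form_exact:
  fixes \<omega> :: "'a::euclidean_space \<Rightarrow> 'a"
  assumes S: "open S" "convex S"
    and d: "\<And>p. p \<in> S \<Longrightarrow> (\<omega> has_derivative \<omega>' p) (at p)"
    and c: "\<And>h. continuous_on S (\<lambda>p. \<omega>' p h)"
    and sym: "\<And>p u v. p \<in> S \<Longrightarrow> \<omega>' p u \<bullet> v = \<omega>' p v \<bullet> u"
  shows "\<exists>H. \<forall>p\<in>S. (H has_derivative (\<lambda>h. \<omega> p \<bullet> h)) (at p)"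
proof (cases "S = {}")
  case False
  then obtain p0 where p0: "p0 \<in> S" by blast
  define q where "q p t = p0 + t *\<^sub>R (p - p0)" for p :: 'a and t :: real
  have qS: "q p t \<in> S" if "p \<in> S" "t \<in> {0..1}" for p t
  proof -
    have "q p t = (1 - t) *\<^sub>R p0 + t *\<^sub>R p" by (simp add: q_def algebra_simps)
    then show ?thesis using S(2) p0 that by (auto simp: convex_alt)
  qed
  have qc: "continuous_on X (\<lambda>z. q (f z) (g z))" if "continuous_on X f" "continuous_on X g"
    for X :: "'z::topological_space set" and f g
    unfolding q_def by (intro continuous_intros that)
  have \<omega>c: "continuous_on S \<omega>"
    using d by (meson continuous_at_imp_continuous_on has_derivative_continuous)
  \<comment> \<open>\<open>fx p t\<close> is the derivative in \<open>p\<close> of the integrand;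
    both the point \<open>q p t\<close> and the direction \<open>p - p0\<close> depend on
    \<open>p\<close>.\<close>
  define fx where "fx p t v = (t *\<^sub>R \<omega>' (q p t) v) \<bullet> (p - p0) + \<omega> (q p t) \<bullet> v" for p t v
  define Fx where "Fx p t = (if p \<in> S \<and> t \<in> {0..1} then Blinfun (fx p t) else 0)" for p t
  have df: "((\<lambda>p. \<omega> (q p t) \<bullet> (p - p0)) has_derivative fx p t) (at p)"
    if "p \<in> S" "t \<in> {0..1}" for p t
  proof -
    have "((\<lambda>p. q p t) has_derivative (\<lambda>v. t *\<^sub>R v)) (at p)"
      unfolding q_def by (auto intro!: derivative_eq_intros)
    from has_derivative_compose[OF this d[OF qS[OF that]]]
    have "((\<lambda>p. \<omega> (q p t)) has_derivative (\<lambda>v. t *\<^sub>R \<omega>' (q p t) v)) (at p)"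
      by (simp add: linear_cmul[OF has_derivative_linear[OF d[OF qS[OF that]]]])
    then show ?thesis
      unfolding fx_def by (auto intro!: derivative_eq_intros simp: add.commute)
  qed
  have Fx: "blinfun_apply (Fx p t) = fx p t" if "p \<in> S" "t \<in> {0..1}" for p t
    using df[OF that] that
    by (simp add: Fx_def bounded_linear_Blinfun_apply has_derivative_bounded_linear)
  have Fc: "continuous_on (S \<times> cbox 0 1) (\<lambda>(p, t). Fx p t)"
  proof (rule continuous_on_blinfun_componentwise)
    fix i :: 'a
    have "continuous_on (S \<times> {0..1}) (\<lambda>z. fx (fst z) (snd z) i)"
      unfolding fx_def
      by (intro continuous_intros continuous_on_compose2[OF c] continuous_on_compose2[OF \<omega>c] qc)
         (auto intro!: qS)
    then show "continuous_on (S \<times> cbox 0 1) (\<lambda>z. blinfun_apply (case z of (p, t) \<Rightarrow> Fx p t) i)"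
      by (rule continuous_on_cong[THEN iffD1, rotated 2]) (auto simp: Fx)
  qed
  define H where "H p = integral {0..1} (\<lambda>t. \<omega> (q p t) \<bullet> (p - p0))" for p
  have "(H has_derivative (\<lambda>h. \<omega> p \<bullet> h)) (at p)" if p: "p \<in> S" for p
  proof -
    have "(H has_derivative blinfun_apply (integral (cbox 0 1) (Fx p))) (at p within S)"
      unfolding H_def box_real(2)[symmetric]
    proof (rule leibniz_rule[OF _ _ Fc p S(2)])
      show "((\<lambda>p. \<omega> (q p t) \<bullet> (p - p0)) has_derivative blinfun_apply (Fx p t)) (at p within S)"
        if "p \<in> S" "t \<in> cbox 0 1" for p t
        using df[of p t] Fx[of p t] that by (auto intro: has_derivative_at_withinI)
      show "(\<lambda>t. \<omega> (q p t) \<bullet> (p - p0)) integrable_on cbox 0 1" if "p \<in> S" for p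
        using that by (intro integrable_continuous continuous_intros continuous_on_compose2[OF \<omega>c] qc)
          (auto intro!: qS)
    qed
    moreover have "blinfun_apply (integral (cbox 0 1) (Fx p)) v = \<omega> p \<bullet> v" for v
    proof -
      have "continuous_on (cbox 0 1) (Fx p)"
        using continuous_on_compose2[OF Fc, of "cbox 0 1" "\<lambda>t. (p, t)"] p
          continuous_on_Pair[OF continuous_on_const continuous_on_id, of "cbox 0 (1::real)" p] by auto
      then have int: "Fx p integrable_on cbox 0 1" by (rule integrable_continuous)
      have "blinfun_apply (integral (cbox 0 1) (Fx p)) v = integral (cbox 0 1) (\<lambda>t. blinfun_apply (Fx p t) v)"
        by (rule blinfun_apply_integral[OF int])
      also have "\<dots> = integral {0..1} (\<lambda>t. fx p t v)"
        by (auto intro!: integral_cong simp: Fx p)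
      \<comment> \<open>By the symmetry of \<open>\<omega>'\<close>, \<open>fx p t v\<close> is also
        the derivative in \<open>t\<close> of \<open>t\<close> times
        \<open>\<omega> (q p t) \<bullet> v\<close>, so the integral is a difference of boundary
        values.\<close>
      also have "((\<lambda>t. fx p t v) has_integral (1 *\<^sub>R \<omega> (q p 1) \<bullet> v - 0 *\<^sub>R \<omega> (q p 0) \<bullet> v)) {0..1}"
      proof (rule fundamental_theorem_of_calculus)
        fix t :: real assume t: "t \<in> {0..1}"
        have "((\<lambda>t. q p t) has_derivative (\<lambda>s. s *\<^sub>R (p - p0))) (at t)"
          unfolding q_def by (auto intro!: derivative_eq_intros)
        from has_derivative_compose[OF this d[OF qS[OF p t]]]
        have "((\<lambda>t. \<omega> (q p t)) has_derivative (\<lambda>s. s *\<^sub>R \<omega>' (q p t) (p - p0))) (at t)"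
          by (simp add: linear_cmul[OF has_derivative_linear[OF d[OF qS[OF p t]]]])
        then have "((\<lambda>t. t *\<^sub>R \<omega> (q p t) \<bullet> v) has_derivative
            (\<lambda>s. s *\<^sub>R fx p t v)) (at t)"
          unfolding fx_def
          by (auto intro!: derivative_eq_intros simp: sym[OF qS[OF p t], of v] distrib_left)
        then show "((\<lambda>t. t *\<^sub>R \<omega> (q p t) \<bullet> v) has_vector_derivative fx p t v) (at t within {0..1})"
          unfolding has_vector_derivative_def by (rule has_derivative_at_withinI)
      qed simp
      then have "integral {0..1} (\<lambda>t. fx p t v) = \<omega> p \<bullet> v"
        by (simp add: integral_unique q_def)
      finally show ?thesis .
    qed
    ultimately show ?thesis
      using at_within_open[OF p S(1)] by (metis (no_types, lifting) ext)
  qed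
  then show ?thesis by blast
qed simp

lemma linear_plane:
  fixes L :: "real \<times> real \<Rightarrow> real"
  assumes "linear L"
  shows "L h = fst h * L (1, 0) + snd h * L (0, 1)"
  using linear_add[OF assms, of "(fst h, 0)" "(0, snd h)"] linear_cmul[OF assms, of "fst h" "(1, 0)"]
    linear_cmul[OF assms, of "snd h" "(0, 1)"] by (simp add: scaleR_prod_def)

text \<open>The symmetry demanded by \<open>closed_form_exact\<close> is bilinear in the two
  directions, so on the plane it reduces to the two coordinate directions.\<close>

lemma closed_form_exact_plane:
  fixes f g :: "real \<times> real \<Rightarrow> real"
  assumes "open S" "convex S"
    and f: "\<And>p. p \<in> S \<Longrightarrow> (f has_derivative f' p) (at p)" "\<And>h. continuous_on S (\<lambda>p. f' p h)"
    and g: "\<And>p. p \<in> S \<Longrightarrow> (g has_derivative g' p) (at p)" "\<And>h. continuous_on S (\<lambda>p. g' p h)"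
    and closed: "\<And>p. p \<in> S \<Longrightarrow> f' p (0, 1) = g' p (1, 0)"
  obtains H where "\<And>p. p \<in> S \<Longrightarrow> (H has_derivative (\<lambda>h. f p * fst h + g p * snd h)) (at p)"
proof -
  have "\<exists>H. \<forall>p\<in>S. (H has_derivative (\<lambda>h. (f p, g p) \<bullet> h)) (at p)"
  proof (rule closed_form_exact[OF assms(1,2), where \<omega>' = "\<lambda>p h. (f' p h, g' p h)"])
    fix p u v assume p: "p \<in> S"
    show "(f' p u, g' p u) \<bullet> v = (f' p v, g' p v) \<bullet> u"
      using closed[OF p] linear_plane[OF has_derivative_linear[OF f(1)[OF p]], of u]
        linear_plane[OF has_derivative_linear[OF f(1)[OF p]], of v]
        linear_plane[OF has_derivative_linear[OF g(1)[OF p]], of u]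
        linear_plane[OF has_derivative_linear[OF g(1)[OF p]], of v]
      by (simp add: inner_prod_def algebra_simps)
  qed (auto intro!: has_derivative_Pair continuous_intros f g)
  then show ?thesis using that by (auto simp: inner_prod_def)
qed

section \<open>Reversal in the Clifford algebra\<close>

interpretation cmul: bounded_bilinear "cmul :: 'm::{finite,linorder} clifford \<Rightarrow> _"
  by (rule bounded_bilinear_cmul)

lemma csign_square: "csign A B * csign A B = 1"
  by (simp add: csign_def flip: power_add mult_2)

text \<open>An index of \<open>A\<close> other than \<open>j\<close> lies on exactly one side of
  \<open>j\<close> and is counted by one of the two signs; \<open>j\<close> itself is counted by
  both. The product is the sign of commuting \<open>e_j\<close> past \<open>e_A\<close>.\<close>

lemma csign_swap_singleton:
  "csign {j} A * csign A {j} = (-1) ^ card (A - {j})"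
proof -
  have "csign {j} A * csign A {j} = (\<Prod>i\<in>A. if i = j then 1 else -1)"
    by (auto simp: csign_eq_prod simp flip: prod.distrib intro!: prod.cong)
  also have "\<dots> = (\<Prod>i\<in>A - {j}. -1)"
    by (intro prod.mono_neutral_cong_right) auto
  finally show ?thesis by simp
qed

text \<open>The sign of the reversal on \<open>e\<^sub>A\<close>, usually \<open>(-1) ^ (|A| (|A| - 1) / 2)\<close>. In this form the
  bimultiplicativity of \<^const>\<open>csign\<close> gives its behaviour on products.\<close>

definition rsign :: "'m::{finite,linorder} set \<Rightarrow> real" where
  "rsign A = csign A A * (-1) ^ card A"

text \<open>Expanding \<open>csign\<close> of the symmetric difference with itself gives four signs,
  of which \<open>csign A B\<close> cancels against the one in front. This is the
  antimultiplicativity of reversal on basis elements.\<close>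

lemma rsign_symdiff:
  "csign A B * rsign ((A - B) \<union> (B - A)) = rsign A * rsign B * csign B A"
proof -
  have "(-1 :: real) ^ card ((A - B) \<union> (B - A)) = (-1) ^ card A * (-1) ^ card B"
    using prod_symdiff[of "\<lambda>_. -1" A B] by simp
  then have "csign A B * rsign ((A - B) \<union> (B - A)) =
      (csign A B * csign A B) * (rsign A * rsign B * csign B A)"
    by (simp add: rsign_def csign_symdiff_left csign_symdiff_right ac_simps)
  then show ?thesis by (simp add: csign_square)
qed

lemma rsign_square: "rsign A * rsign A = 1"
proof -
  have "rsign A * rsign A = (csign A A * csign A A) * ((-1) ^ card A * (-1) ^ card A)"
    by (simp only: rsign_def ac_simps)
  then show ?thesis by (simp add: csign_square flip: power_mult_distrib)
qed

text \<open>Adding \<open>j\<close> to \<open>A\<close> multiplies \<open>csign A A\<close> by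
  \<open>csign {j} {j} = -1\<close>, which cancels the new factor of \<open>(-1) ^ card\<close>, and
  by the two mixed signs, which together give \<open>(-1) ^ card A\<close>. Hence only the grade
  matters.\<close>

lemma rsign_eq_card:
  "rsign A = (\<Prod>n<card A. (-1) ^ n)"
  using finite[of A]
proof (induction A rule: finite_induct)
  case (insert j A)
  then have un: "insert j A = ({j} - A) \<union> (A - {j})" by auto
  have "rsign (insert j A) = csign A A * csign {j} {j} * (csign {j} A * csign A {j}) * (-1) ^ card (insert j A)"
    unfolding rsign_def by (simp only: un csign_symdiff_left csign_symdiff_right ac_simps)
  also have "csign {j} A * csign A {j} = (-1) ^ card A"
    using insert by (simp add: csign_swap_singleton)
  also have "csign {j} {j} = -1" by (simp add: csign_eq_prod)
  finally have "rsign (insert j A) = rsign A * (-1) ^ card A"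
    using insert by (simp add: rsign_def)
  then show ?case using insert by simp
qed (simp add: rsign_def csign_def)

text \<open>The linear antiautomorphism fixing the generators. Given by coordinates rather than by
  reversing words, it is visibly linear, and antimultiplicativity reduces to
  \<open>rsign_symdiff\<close>.\<close>

definition crev :: "'m::{finite,linorder} clifford \<Rightarrow> 'm clifford" where
  "crev a = (\<Sum>A\<in>UNIV. (a $ A * rsign A) *\<^sub>R cbase A)"

lemma bounded_linear_crev: "bounded_linear (crev :: 'm::{finite,linorder} clifford \<Rightarrow> _)"
  by (rule linear_conv_bounded_linear[THEN iffD1], rule linearI)
     (simp_all add: crev_def algebra_simps sum.distrib scaleR_sum_right)

lemmas crev_add = linear_add[OF bounded_linear.linear[OF bounded_linear_crev]]
  and crev_scaleR = linear_cmul[OF bounded_linear.linear[OF bounded_linear_crev]]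
  and crev_sum = linear_sum[OF bounded_linear.linear[OF bounded_linear_crev]]

lemma crev_cbase: "crev (cbase A) = rsign A *\<^sub>R cbase A"
proof -
  have "crev (cbase A) = (\<Sum>B\<in>UNIV. if B = A then rsign A *\<^sub>R cbase A else 0)"
    unfolding crev_def by (intro sum.cong) (auto simp: cbase_def axis_def)
  then show ?thesis by simp
qed

lemma crev_cgen: "crev (cgen j) = cgen j"
  by (simp add: crev_cbase rsign_def csign_eq_prod)

lemma crev_cvec: "crev (cvec x) = cvec x"
  by (simp add: cvec_def crev_sum crev_scaleR crev_cgen)

lemma clifford_eqI:
  assumes "linear f" "linear g" "\<And>A. f (cbase A) = g (cbase A)"
  shows "f a = g (a :: 'm::{finite,linorder} clifford)"
  by (subst (1 2) clifford_eq_sum_cbase)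
     (simp add: linear_sum[OF assms(1)] linear_sum[OF assms(2)] linear_cmul[OF assms(1)]
       linear_cmul[OF assms(2)] assms(3))

lemma crev_crev: "crev (crev a) = a"
  by (rule clifford_eqI[of "\<lambda>a. crev (crev a)" "\<lambda>a. a"])
     (auto intro!: linearI simp: crev_add crev_scaleR crev_cbase rsign_square)

lemma crev_cmul: "crev (a \<odot> b) = crev b \<odot> crev a"
proof -
  have base: "crev (cbase A \<odot> cbase B) = crev (cbase B) \<odot> crev (cbase A)" for A B :: "'a set"
  proof -
    have "crev (cbase A \<odot> cbase B) = (csign A B * rsign ((A - B) \<union> (B - A))) *\<^sub>R cbase ((A - B) \<union> (B - A))"
      by (simp add: cmul_cbase crev_scaleR crev_cbase)
    also have "\<dots> = (rsign A * rsign B * csign B A) *\<^sub>R cbase ((B - A) \<union> (A - B))"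
      by (simp only: rsign_symdiff Un_commute)
    finally show ?thesis
      by (simp add: cmul_cbase crev_cbase cmul.scaleR_left cmul.scaleR_right mult_ac)
  qed
  have left: "crev (cbase A \<odot> b) = crev b \<odot> crev (cbase A)" for A
    by (rule clifford_eqI[of "\<lambda>b. crev (cbase A \<odot> b)" "\<lambda>b. crev b \<odot> crev (cbase A)"])
       (auto intro!: linearI simp: base crev_add crev_scaleR cmul.add_left cmul.add_right cmul.scaleR_left cmul.scaleR_right)
  show ?thesis
    by (rule clifford_eqI[of "\<lambda>a. crev (a \<odot> b)" "\<lambda>a. crev b \<odot> crev a"])
       (auto intro!: linearI simp: left crev_add crev_scaleR cmul.add_left cmul.add_right cmul.scaleR_left cmul.scaleR_right)
qed

lemma multivectors_eqI:
  assumes "linear f" "linear g" "\<And>A. card A = l \<Longrightarrow> f (cbase A) = g (cbase A)" "a \<in> multivectors l"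
  shows "f a = g a"
  by (rule linear_eq_on_span[OF assms(1,2) _ assms(4)[unfolded multivectors_def]])
     (use assms(3) in auto)

text \<open>The reversal sign depends on the grade alone, so on \<open>l\<close>-vectors reversal is
  a scalar. This is why reversing a product built from \<open>P\<close> leads back to the same
  \<open>P\<close>.\<close>

lemma crev_multivector:
  assumes "a \<in> multivectors l"
  shows "crev a = (\<Prod>n<l. (-1) ^ n) *\<^sub>R a"
  by (rule multivectors_eqI[OF _ _ _ assms])
     (auto intro!: linearI simp: crev_add crev_scaleR crev_cbase rsign_eq_card algebra_simps)

definition msign :: "nat \<Rightarrow> nat \<Rightarrow> real" where
  "msign m l = (-1) ^ Suc l * (real m - 2 * real l)"

text \<open>The map \<open>a\<close> to \<open>e_j a e_j\<close> multiplies \<open>e_A\<close> by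
  \<open>(-1) ^ l\<close> for the \<open>l\<close> indices in \<open>A\<close> and by the opposite
  sign for the remaining \<open>m - l\<close>; \<open>msign\<close> is the total.\<close>

lemma sum_cgen_multivector_cgen:
  fixes a :: "'m::{finite,linorder} clifford"
  assumes "a \<in> multivectors l"
  shows "(\<Sum>j\<in>UNIV. cgen j \<odot> a \<odot> cgen j) = msign CARD('m) l *\<^sub>R a"
proof (rule multivectors_eqI[OF _ _ _ assms])
  fix A :: "'m set" assume l: "card A = l"
  have "cgen j \<odot> cbase A \<odot> cgen j = (if j \<in> A then (-1) ^ l else (-1) ^ Suc l) *\<^sub>R cbase A" for j
  proof -
    have "cgen j \<odot> cbase A \<odot> cgen j = (csign {j} A * csign A {j} * csign {j} {j}) *\<^sub>R
        cbase ((({j} - A \<union> (A - {j})) - {j}) \<union> ({j} - ({j} - A \<union> (A - {j}))))"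
      by (simp add: cmul_cbase cmul.scaleR_left csign_symdiff_left mult_ac)
    also have "(({j} - A \<union> (A - {j})) - {j}) \<union> ({j} - ({j} - A \<union> (A - {j}))) = A" by auto
    also have "csign {j} A * csign A {j} * csign {j} {j} = (-1) ^ Suc (card (A - {j}))"
      by (simp add: csign_swap_singleton) (simp add: csign_eq_prod)
    also have "\<dots> = (if j \<in> A then (-1) ^ l else (-1) ^ Suc l)"
      by (cases "j \<in> A")
         (simp_all only: l[symmetric] card_Suc_Diff1 finite Diff_insert0 Diff_empty if_True if_False not_False_eq_True)
    finally show ?thesis .
  qed
  moreover have "(\<Sum>j\<in>UNIV. if j \<in> A then (-1) ^ l else (-1 :: real) ^ Suc l) = msign CARD('m) l"
  proof -
    have "card (- A) = CARD('m) - l" "l \<le> CARD('m)"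
      using l by (auto simp: Compl_eq_Diff_UNIV card_Diff_subset card_mono)
    then show ?thesis
      using l by (simp add: sum.If_cases msign_def of_nat_diff algebra_simps)
  qed
  ultimately show "(\<Sum>j\<in>UNIV. cgen j \<odot> cbase A \<odot> cgen j) = msign CARD('m) l *\<^sub>R cbase A"
    by (simp flip: scaleR_sum_left)
qed (auto intro!: linearI simp: cmul.add_left cmul.add_right cmul.scaleR_left cmul.scaleR_right
      sum.distrib scaleR_sum_right algebra_simps)

section \<open>The vector variable as an element of the algebra\<close>

lemma bounded_linear_cvec: "bounded_linear (cvec :: 'm::{finite,linorder} euclid \<Rightarrow> _)"
  by (rule linear_conv_bounded_linear[THEN iffD1], rule linearI)
     (simp_all add: cvec_def algebra_simps sum.distrib scaleR_sum_right)

lemmas cvec_scaleR = linear_cmul[OF bounded_linear.linear[OF bounded_linear_cvec]]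

lemma cvec_zero: "cvec 0 = 0"
  by (simp add: cvec_def)

lemma cvec_axis: "cvec (axis j 1) = cgen j"
proof -
  have "cvec (axis j 1) = (\<Sum>i\<in>UNIV. if i = j then cgen j else 0)"
    unfolding cvec_def by (intro sum.cong) (auto simp: axis_def)
  then show ?thesis by simp
qed

lemma cgen_cvec: "cgen j \<odot> cvec x = - (cvec x \<odot> cgen j) - (2 * x $ j) *\<^sub>R cunit"
proof -
  have "cgen j \<odot> cvec x + cvec x \<odot> cgen j = (\<Sum>i\<in>UNIV. (x $ i) *\<^sub>R (cgen j \<odot> cgen i + cgen i \<odot> cgen j))"
    by (simp add: cvec_def cmul.sum_left cmul.sum_right cmul.scaleR_left cmul.scaleR_right
        scaleR_add_right sum.distrib)
  also have "\<dots> = (\<Sum>i\<in>UNIV. if i = j then (-2 * x $ j) *\<^sub>R cunit else 0)"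
    by (intro sum.cong) (auto simp: cgen_anticommute)
  also have "\<dots> = (-2 * x $ j) *\<^sub>R cunit" by simp
  finally show ?thesis by (simp add: algebra_simps eq_neg_iff_add_eq_0)
qed

text \<open>Moving each generator of the left factor past \<open>x\<close> turns the square into its
  own negative minus twice the squared norm.\<close>

lemma cvec_square: "cvec x \<odot> cvec x = - ((norm x)\<^sup>2 *\<^sub>R cunit)"
proof -
  have "cvec x \<odot> cvec x = (\<Sum>j\<in>UNIV. x $ j *\<^sub>R (cgen j \<odot> cvec x))"
    by (subst (1) cvec_def) (simp add: cmul.sum_left cmul.scaleR_left)
  also have "\<dots> = (\<Sum>j\<in>UNIV. - (x $ j *\<^sub>R (cvec x \<odot> cgen j)) - (2 * (x $ j)\<^sup>2) *\<^sub>R cunit)"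
    by (simp add: cgen_cvec algebra_simps power2_eq_square)
  also have "\<dots> = - (cvec x \<odot> cvec x) - (2 * (norm x)\<^sup>2) *\<^sub>R cunit"
    by (subst (3) cvec_def)
       (simp add: cmul.sum_right cmul.scaleR_right sum_subtractf sum_negf norm_vec_def L2_set_def
         sum_nonneg sum_distrib_left flip: scaleR_sum_left)
  finally have "cvec x \<odot> cvec x + cvec x \<odot> cvec x =
      cvec x \<odot> cvec x + (- (cvec x \<odot> cvec x) - (2 * (norm x)\<^sup>2) *\<^sub>R cunit)"
    by (rule arg_cong)
  then have "2 *\<^sub>R (cvec x \<odot> cvec x) = 2 *\<^sub>R (- ((norm x)\<^sup>2 *\<^sub>R cunit))"
    by (simp only: scaleR_2) (simp flip: scaleR_2)
  then show ?thesis by (metis scaleR_left_imp_eq zero_neq_numeral)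
qed

section \<open>The Dirac operator on axial functions\<close>

lemma pderiv_at_eq:
  assumes "(f has_derivative f') (at x)"
  shows "pderiv_at j f x = f' (axis j 1)"
proof -
  have "((\<lambda>t. x + t *\<^sub>R axis j 1) has_derivative (\<lambda>t. t *\<^sub>R axis j 1)) (at 0)"
    by (auto intro!: derivative_eq_intros)
  from has_derivative_compose[OF this, of f f'] assms
  have "((\<lambda>t. f (x + t *\<^sub>R axis j 1)) has_vector_derivative f' (axis j 1)) (at 0)"
    by (simp add: has_vector_derivative_def linear_cmul[OF has_derivative_linear[OF assms]])
  then show ?thesis
    unfolding pderiv_at_def by (rule vector_derivative_at)
qed

lemma dirac_left_eq:
  "(f has_derivative f') (at x) \<Longrightarrow> dirac_left f x = (\<Sum>j\<in>UNIV. cgen j \<odot> f' (axis j 1))"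
  by (simp add: dirac_left_def pderiv_at_eq)

lemma dirac_right_eq:
  "(f has_derivative f') (at x) \<Longrightarrow> dirac_right f x = (\<Sum>j\<in>UNIV. f' (axis j 1) \<odot> cgen j)"
  by (simp add: dirac_right_def pderiv_at_eq)

lemma dirac_right_conv_left:
  assumes "f differentiable at x"
  shows "dirac_right f x = crev (dirac_left (\<lambda>y. crev (f y)) x)"
proof -
  obtain f' where f': "(f has_derivative f') (at x)"
    using assms by (auto simp: differentiable_def)
  have "((\<lambda>y. crev (f y)) has_derivative (\<lambda>h. crev (f' h))) (at x)"
    by (rule bounded_linear.has_derivative[OF bounded_linear_crev f'])
  then show ?thesis
    by (simp add: dirac_left_eq dirac_right_eq[OF f'] crev_sum crev_cmul crev_crev crev_cgen)
qed

lemma dirac_left_add: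
  assumes "f differentiable at x" "g differentiable at x"
  shows "dirac_left (\<lambda>y. f y + g y) x = dirac_left f x + dirac_left g x"
proof -
  obtain f' g' where "(f has_derivative f') (at x)" "(g has_derivative g') (at x)"
    using assms by (auto simp: differentiable_def)
  note d = this
  show ?thesis
    by (simp add: dirac_left_eq[OF d(1)] dirac_left_eq[OF d(2)] dirac_left_eq[OF has_derivative_add[OF d]]
        cmul.add_right sum.distrib)
qed

lemma dirac_left_scaleR:
  assumes "f differentiable at x"
  shows "dirac_left (\<lambda>y. c *\<^sub>R f y) x = c *\<^sub>R dirac_left f x"
proof -
  obtain f' where d: "(f has_derivative f') (at x)"
    using assms by (auto simp: differentiable_def)
  show ?thesis
    by (simp add: dirac_left_eq[OF d] dirac_left_eq[OF has_derivative_scaleR_right[OF d]]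
        cmul.scaleR_right scaleR_sum_right)
qed

text \<open>The gradient of \<open>a (norm y)\<close> at \<open>x\<close> is
  \<open>a' / norm x\<close> times \<open>x\<close>, and pairing its components with the generators
  reproduces \<open>cvec x\<close>.\<close>

lemma dirac_left_radial:
  assumes a: "(a has_real_derivative a') (at (norm x))" and "x \<noteq> 0" and "f differentiable at x"
  shows "dirac_left (\<lambda>y. a (norm y) *\<^sub>R f y) x =
    a (norm x) *\<^sub>R dirac_left f x + (a' / norm x) *\<^sub>R (cvec x \<odot> f x)"
proof -
  obtain f' where f': "(f has_derivative f') (at x)"
    using assms by (auto simp: differentiable_def)
  have "(norm has_derivative (\<lambda>h. x \<bullet> h / norm x)) (at x)"
    using has_derivative_norm[OF \<open>x \<noteq> 0\<close>]
    by (simp add: sgn_div_norm divide_inverse mult.commute inner_commute)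
  from has_derivative_compose[OF this a[unfolded has_field_derivative_def]]
  have "((\<lambda>y. a (norm y)) has_derivative (\<lambda>h. a' * (x \<bullet> h / norm x))) (at x)" .
  from has_derivative_scaleR[OF this f']
  have "dirac_left (\<lambda>y. a (norm y) *\<^sub>R f y) x =
    (\<Sum>j\<in>UNIV. cgen j \<odot> (a (norm x) *\<^sub>R f' (axis j 1) + (a' * (x \<bullet> axis j 1 / norm x)) *\<^sub>R f x))"
    by (rule dirac_left_eq)
  also have "\<dots> = a (norm x) *\<^sub>R dirac_left f x + (a' / norm x) *\<^sub>R (cvec x \<odot> f x)"
    by (simp add: dirac_left_eq[OF f'] cmul.add_right sum.distrib cmul.scaleR_right scaleR_sum_right
        cvec_def cmul.sum_left cmul.scaleR_left inner_axis)
  finally show ?thesis .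
qed

lemma radial_differentiable:
  fixes x :: "'a::real_inner" and g :: "'a \<Rightarrow> 'b::real_normed_vector"
  assumes "x \<noteq> 0" "(f has_real_derivative f') (at (norm x))" "g differentiable at x"
  shows "(\<lambda>y. f (norm y) *\<^sub>R g y) differentiable at x"
proof -
  have "(norm has_derivative (\<lambda>h. h \<bullet> sgn x)) (at x)"
    by (rule has_derivative_norm[OF assms(1)])
  from has_derivative_compose[OF this assms(2)[unfolded has_field_derivative_def]] assms(3)
  show ?thesis unfolding differentiable_def using has_derivative_scaleR by blast
qed

lemma cvec_differentiable: "f differentiable at x \<Longrightarrow> (\<lambda>y. cvec (f y)) differentiable at x"
  unfolding differentiable_def using bounded_linear.has_derivative[OF bounded_linear_cvec] by blast

lemma cmul_differentiable:
  "f differentiable at x \<Longrightarrow> g differentiable at x \<Longrightarrow> (\<lambda>y. f y \<odot> g y) differentiable at x"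
  unfolding differentiable_def using cmul.FDERIV by blast

lemma cvec_has_derivative: "(cvec has_derivative cvec) (at x)"
  by (rule bounded_linear_imp_has_derivative[OF bounded_linear_cvec])

lemma euclid_eq_sum_axis: "x = (\<Sum>j\<in>UNIV. (x $ j) *\<^sub>R (axis j 1 :: 'm::finite euclid))"
  by (simp add: vec_eq_iff axis_def if_distrib cong: if_cong)

text \<open>Moving \<open>e_j\<close> past \<open>x\<close> leaves the corrections
  \<open>-2 x_j\<close> times the partial derivatives, which add up to the derivative in the
  direction \<open>x\<close>; the squares \<open>e_j e_j = -1\<close> contribute the
  dimension.\<close>

lemma dirac_left_cvec_cmul:
  fixes f :: "'m::{finite,linorder} euclid \<Rightarrow> 'm clifford"
  assumes f': "(f has_derivative f') (at x)"
  shows "dirac_left (\<lambda>y. cvec y \<odot> f y) x =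
    - (cvec x \<odot> dirac_left f x) - 2 *\<^sub>R f' x - real CARD('m) *\<^sub>R f x"
proof -
  have lin: "linear f'" by (rule has_derivative_linear[OF f'])
  have "dirac_left (\<lambda>y. cvec y \<odot> f y) x =
      (\<Sum>j\<in>UNIV. cgen j \<odot> (cvec x \<odot> f' (axis j 1) + cvec (axis j 1) \<odot> f x))"
    by (rule dirac_left_eq[OF cmul.FDERIV[OF cvec_has_derivative f']])
  also have "\<dots> = (\<Sum>j\<in>UNIV. - (cvec x \<odot> (cgen j \<odot> f' (axis j 1))) - 2 *\<^sub>R (x $ j *\<^sub>R f' (axis j 1)) - f x)"
  proof (rule sum.cong)
    fix j :: 'm
    have "cgen j \<odot> cgen j = - cunit"
      by (simp add: cmul_cbase csign_eq_prod)
    then have "cgen j \<odot> (cvec (axis j 1) \<odot> f x) = - f x"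
      by (simp add: cvec_axis cunit_cmul cmul.minus_left flip: cmul_assoc)
    then show "cgen j \<odot> (cvec x \<odot> f' (axis j 1) + cvec (axis j 1) \<odot> f x) =
        - (cvec x \<odot> (cgen j \<odot> f' (axis j 1))) - 2 *\<^sub>R (x $ j *\<^sub>R f' (axis j 1)) - f x"
      by (simp add: cmul.add_right cgen_cvec cmul.diff_left cmul.minus_left cmul.scaleR_left cunit_cmul
          flip: cmul_assoc)
  qed simp
  also have "\<dots> = - (cvec x \<odot> dirac_left f x) - 2 *\<^sub>R (\<Sum>j\<in>UNIV. x $ j *\<^sub>R f' (axis j 1)) - real CARD('m) *\<^sub>R f x"
    by (simp add: dirac_left_eq[OF f'] sum_subtractf sum_negf cmul.sum_right scaleR_sum_right sum_constant_scaleR del: sum_constant)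
  also have "(\<Sum>j\<in>UNIV. x $ j *\<^sub>R f' (axis j 1)) = f' x"
    by (subst (2) euclid_eq_sum_axis) (simp add: linear_sum[OF lin] linear_cmul[OF lin])
  finally show ?thesis .
qed

lemma dirac_left_cmul_cvec:
  assumes f: "f differentiable at x"
  shows "dirac_left (\<lambda>y. f y \<odot> cvec y) x = dirac_left f x \<odot> cvec x + (\<Sum>j\<in>UNIV. cgen j \<odot> f x \<odot> cgen j)"
proof -
  obtain f' where f': "(f has_derivative f') (at x)"
    using assms by (auto simp: differentiable_def)
  show ?thesis
    by (simp add: dirac_left_eq[OF f'] dirac_left_eq[OF cmul.FDERIV[OF f' cvec_has_derivative]]
        cvec_axis cmul.add_right sum.distrib cmul.sum_left cmul_assoc add.commute)
qed

text \<open>Needed for \<open>a = P x\<close>: the product \<open>xP\<close> need not have a single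
  grade, so the formula for \<open>l\<close>-vectors applies only after \<open>e_j\<close> has been
  moved past \<open>x\<close>.\<close>

lemma sum_cgen_cvec_cgen:
  "(\<Sum>j\<in>UNIV. cgen j \<odot> (cvec x \<odot> a) \<odot> cgen j) =
    - (cvec x \<odot> (\<Sum>j\<in>UNIV. cgen j \<odot> a \<odot> cgen j)) - 2 *\<^sub>R (a \<odot> cvec x)"
proof -
  have "cgen j \<odot> (cvec x \<odot> a) \<odot> cgen j = - (cvec x \<odot> (cgen j \<odot> a \<odot> cgen j)) - 2 *\<^sub>R (a \<odot> (x $ j *\<^sub>R cgen j))" for j
    by (simp add: cgen_cvec cmul.diff_left cmul.minus_left cmul.scaleR_left cmul.scaleR_right cunit_cmul
        flip: cmul_assoc)
  then show ?thesis
    by (simp add: sum_subtractf sum_negf cmul.sum_right cvec_def scaleR_sum_right cmul.scaleR_right)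
qed

section \<open>Products of a multivector-valued monogenic polynomial with the vector
  variable\<close>

locale multivector_monogenic =
  fixes k l :: nat and n s :: real and P :: "'m::{finite,linorder} euclid \<Rightarrow> 'm clifford"
  assumes monogenic: "P \<in> left_monogenic_polys k" and multivector: "P x \<in> multivectors l"
    and n_def: "n = real CARD('m) + 2 * real k" and s_def: "s = msign CARD('m) l"
begin

abbreviation \<epsilon> :: real where "\<epsilon> \<equiv> \<Prod>i<l. (-1) ^ i"

lemma eps_square: "\<epsilon> * \<epsilon> = 1"
  by (simp flip: prod.distrib power_mult_distrib)

lemma crev_P: "crev (P x) = \<epsilon> *\<^sub>R P x"
  by (rule crev_multivector[OF multivector])

lemma dirac_P: "dirac_left P x = 0"
  using monogenic by (auto simp: left_monogenic_polys_def)

lemma P_scaleR: "P (t *\<^sub>R x) = t ^ k *\<^sub>R P x"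
proof -
  obtain c where P: "P = (\<lambda>x. \<Sum>\<alpha> | (\<Sum>j\<in>UNIV. \<alpha> j) = k. (\<Prod>j\<in>UNIV. x $ j ^ \<alpha> j) *\<^sub>R c \<alpha>)"
    using monogenic by (auto simp: left_monogenic_polys_def homogeneous_poly_def)
  show ?thesis
    unfolding P scaleR_sum_right
    by (rule sum.cong) (auto simp: power_mult_distrib prod.distrib power_sum)
qed

lemma C1_P: "C1_on S P"
proof -
  obtain c where P: "P = (\<lambda>x. \<Sum>\<alpha> | (\<Sum>j\<in>UNIV. \<alpha> j) = k. (\<Prod>j\<in>UNIV. x $ j ^ \<alpha> j) *\<^sub>R c \<alpha>)"
    using monogenic by (auto simp: left_monogenic_polys_def homogeneous_poly_def)
  show ?thesis
    unfolding P
    by (intro C1_on_sum bounded_bilinear.C1_on[OF bounded_bilinear_scaleR] C1_on_prod C1_on_power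
        C1_on_const C1_on_bounded_linear bounded_linear_vec_nth)
qed

lemma P_differentiable: "P differentiable at x"
  using C1_P[of UNIV] by (auto simp: C1_on_def differentiable_def)

text \<open>Euler's identity: both sides of \<open>P (t x) = t ^ k P x\<close> are differentiated at
  \<open>t = 1\<close>.\<close>

lemma euler:
  assumes "(P has_derivative P') (at x)"
  shows "P' x = real k *\<^sub>R P x"
proof -
  have "((\<lambda>t. t *\<^sub>R x) has_derivative (\<lambda>t. t *\<^sub>R x)) (at 1)"
    by (auto intro!: derivative_eq_intros)
  from has_derivative_compose[OF this, of P P'] assms
  have "((\<lambda>t. P (t *\<^sub>R x)) has_derivative (\<lambda>t. P' (t *\<^sub>R x))) (at 1)" by simp
  moreover have "((\<lambda>t. t ^ k *\<^sub>R P x) has_derivative (\<lambda>t. (real k * t) *\<^sub>R P x)) (at 1)"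
    by (auto intro!: derivative_eq_intros)
  ultimately have "(\<lambda>t. P' (t *\<^sub>R x)) = (\<lambda>t. (real k * t) *\<^sub>R P x)"
    unfolding P_scaleR by (rule has_derivative_unique)
  from fun_cong[OF this, of 1] show ?thesis by simp
qed

lemma dirac_xP: "dirac_left (\<lambda>y. cvec y \<odot> P y) x = - n *\<^sub>R P x"
proof -
  obtain P' where P': "(P has_derivative P') (at x)"
    using P_differentiable[of x] by (auto simp: differentiable_def)
  show ?thesis
    by (simp add: dirac_left_cvec_cmul[OF P'] dirac_P euler[OF P'] cmul.zero_right n_def algebra_simps)
qed

lemma dirac_Px: "dirac_left (\<lambda>y. P y \<odot> cvec y) x = s *\<^sub>R P x"
  by (simp add: dirac_left_cmul_cvec[OF P_differentiable] dirac_P cmul.zero_left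
      sum_cgen_multivector_cgen[OF multivector] s_def)

lemma differentiable_products:
  "(\<lambda>y. cvec y \<odot> P y) differentiable at x" "(\<lambda>y. P y \<odot> cvec y) differentiable at x"
  "(\<lambda>y. cvec y \<odot> P y \<odot> cvec y) differentiable at x"
  by (auto intro!: cmul_differentiable cvec_differentiable P_differentiable)

lemma dirac_xPx:
  "dirac_left (\<lambda>y. cvec y \<odot> P y \<odot> cvec y) x = - (n + 2) *\<^sub>R (P x \<odot> cvec x) - s *\<^sub>R (cvec x \<odot> P x)"
proof -
  have "dirac_left (\<lambda>y. cvec y \<odot> P y \<odot> cvec y) x =
      (- n *\<^sub>R P x) \<odot> cvec x + (- (cvec x \<odot> (s *\<^sub>R P x)) - 2 *\<^sub>R (P x \<odot> cvec x))"
    by (subst dirac_left_cmul_cvec[OF differentiable_products(1)])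
       (simp only: dirac_xP sum_cgen_cvec_cgen sum_cgen_multivector_cgen[OF multivector] s_def)
  then show ?thesis
    by (simp add: cmul.scaleR_left cmul.scaleR_right cmul.minus_left algebra_simps)
qed

text \<open>The span of the four products over radial coefficients is stable: derivatives of the
  coefficients bring in a left factor \<open>x\<close>, and \<open>x x\<close> is the scalar
  \<open>- r ^ 2\<close>, so \<open>xP\<close> and \<open>xPx\<close> fall back to \<open>P\<close>
  and \<open>Px\<close>.\<close>

lemma dirac_left_radial_combination:
  assumes x: "x \<noteq> 0"
    and d: "(a has_real_derivative a') (at (norm x))" "(b has_real_derivative b') (at (norm x))"
      "(c has_real_derivative c') (at (norm x))" "(d has_real_derivative d') (at (norm x))"
  shows "dirac_left (\<lambda>y. a (norm y) *\<^sub>R P y + b (norm y) *\<^sub>R (cvec y \<odot> P y)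
      + c (norm y) *\<^sub>R (P y \<odot> cvec y) + d (norm y) *\<^sub>R (cvec y \<odot> P y \<odot> cvec y)) x =
    (- norm x * b' - n * b (norm x) + s * c (norm x)) *\<^sub>R P x
    + (a' / norm x - s * d (norm x)) *\<^sub>R (cvec x \<odot> P x)
    + (- norm x * d' - (n + 2) * d (norm x)) *\<^sub>R (P x \<odot> cvec x)
    + (c' / norm x) *\<^sub>R (cvec x \<odot> P x \<odot> cvec x)"
proof -
  have xx: "cvec x \<odot> (cvec x \<odot> z) = - ((norm x)\<^sup>2 *\<^sub>R z)" for z
    by (simp add: cvec_square cmul.minus_left cmul.scaleR_left cunit_cmul flip: cmul_assoc)
  note nds = radial_differentiable[OF x d(1) P_differentiable] radial_differentiable[OF x d(2) differentiable_products(1)]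
    radial_differentiable[OF x d(3) differentiable_products(2)] radial_differentiable[OF x d(4) differentiable_products(3)]
  have "dirac_left (\<lambda>y. a (norm y) *\<^sub>R P y + b (norm y) *\<^sub>R (cvec y \<odot> P y)
      + c (norm y) *\<^sub>R (P y \<odot> cvec y) + d (norm y) *\<^sub>R (cvec y \<odot> P y \<odot> cvec y)) x =
    dirac_left (\<lambda>y. a (norm y) *\<^sub>R P y) x + dirac_left (\<lambda>y. b (norm y) *\<^sub>R (cvec y \<odot> P y)) x
    + dirac_left (\<lambda>y. c (norm y) *\<^sub>R (P y \<odot> cvec y)) x
    + dirac_left (\<lambda>y. d (norm y) *\<^sub>R (cvec y \<odot> P y \<odot> cvec y)) x"
    by (simp only: dirac_left_add nds differentiable_add)
  also note dirac_left_radial[OF d(1) x P_differentiable]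
  also note dirac_left_radial[OF d(2) x differentiable_products(1)]
  also note dirac_left_radial[OF d(3) x differentiable_products(2)]
  also note dirac_left_radial[OF d(4) x differentiable_products(3)]
  finally show ?thesis
    using x
    by (simp only: dirac_P dirac_xP dirac_Px dirac_xPx)
      (simp add: xx cmul_assoc cmul.minus_left algebra_simps power2_eq_square)
qed

lemma dirac_axial_two_sided:
  assumes x: "x \<noteq> 0"
    and d: "(A has_derivative A') (at (x0, norm x))" "(B has_derivative B') (at (x0, norm x))"
      "(C has_derivative C') (at (x0, norm x))" "(D has_derivative D') (at (x0, norm x))"
  shows "dx0 (axial_two_sided A B C D P) (x0, x) =
      A' (1, 0) *\<^sub>R P x + B' (1, 0) *\<^sub>R (cvec x \<odot> P x) + C' (1, 0) *\<^sub>R (P x \<odot> cvec x)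
      + D' (1, 0) *\<^sub>R (cvec x \<odot> P x \<odot> cvec x)"
    and "dirac_left (\<lambda>y. axial_two_sided A B C D P (x0, y)) x =
      (- norm x * B' (0, 1) - n * B (x0, norm x) + s * C (x0, norm x)) *\<^sub>R P x
      + (A' (0, 1) / norm x - s * D (x0, norm x)) *\<^sub>R (cvec x \<odot> P x)
      + (- norm x * D' (0, 1) - (n + 2) * D (x0, norm x)) *\<^sub>R (P x \<odot> cvec x)
      + (C' (0, 1) / norm x) *\<^sub>R (cvec x \<odot> P x \<odot> cvec x)"
    and "dirac_right (\<lambda>y. axial_two_sided A B C D P (x0, y)) x =
      (- norm x * C' (0, 1) - n * C (x0, norm x) + s * B (x0, norm x)) *\<^sub>R P x
      + (- norm x * D' (0, 1) - (n + 2) * D (x0, norm x)) *\<^sub>R (cvec x \<odot> P x)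
      + (A' (0, 1) / norm x - s * D (x0, norm x)) *\<^sub>R (P x \<odot> cvec x)
      + (B' (0, 1) / norm x) *\<^sub>R (cvec x \<odot> P x \<odot> cvec x)"
proof -
  have dr: "((\<lambda>r. f (x0, r)) has_real_derivative f' (0, 1)) (at r)"
    and d0: "((\<lambda>t. f (t, r)) has_real_derivative f' (1, 0)) (at x0)"
    if "(f has_derivative f') (at (x0, r))" for f :: "real \<times> real \<Rightarrow> real" and f' r
  proof -
    have lin: "linear f'" by (rule has_derivative_linear[OF that])
    have "((\<lambda>r. (x0, r)) has_derivative (\<lambda>h. h *\<^sub>R (0, 1))) (at r)"
      by (auto intro!: derivative_eq_intros)
    from has_derivative_compose[OF this that]
    show "((\<lambda>r. f (x0, r)) has_real_derivative f' (0, 1)) (at r)"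
      by (simp add: has_field_derivative_def linear_cmul[OF lin] mult_commute_abs del: scaleR_Pair)
    have "((\<lambda>t. (t, r)) has_derivative (\<lambda>h. h *\<^sub>R (1, 0))) (at x0)"
      by (auto intro!: derivative_eq_intros)
    from has_derivative_compose[OF this that]
    show "((\<lambda>t. f (t, r)) has_real_derivative f' (1, 0)) (at x0)"
      by (simp add: has_field_derivative_def linear_cmul[OF lin] mult_commute_abs del: scaleR_Pair)
  qed
  have dx: "((\<lambda>t. f (t, norm x) *\<^sub>R z) has_vector_derivative f' (1, 0) *\<^sub>R z) (at x0)"
    if "(f has_derivative f') (at (x0, norm x))" for f f' and z :: "'m clifford"
    using has_vector_derivative_scaleR[OF d0[OF that] has_vector_derivative_const] by simp
  have "((\<lambda>t. axial_two_sided A B C D P (t, x)) has_vector_derivative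
      A' (1, 0) *\<^sub>R P x + B' (1, 0) *\<^sub>R (cvec x \<odot> P x) + C' (1, 0) *\<^sub>R (P x \<odot> cvec x)
      + D' (1, 0) *\<^sub>R (cvec x \<odot> P x \<odot> cvec x)) (at x0)"
    unfolding axial_two_sided_def Let_def prod.case
    by (intro has_vector_derivative_add dx d)
  then show "dx0 (axial_two_sided A B C D P) (x0, x) =
      A' (1, 0) *\<^sub>R P x + B' (1, 0) *\<^sub>R (cvec x \<odot> P x) + C' (1, 0) *\<^sub>R (P x \<odot> cvec x)
      + D' (1, 0) *\<^sub>R (cvec x \<odot> P x \<odot> cvec x)"
    by (simp add: dx0_def vector_derivative_at)
  show "dirac_left (\<lambda>y. axial_two_sided A B C D P (x0, y)) x =
      (- norm x * B' (0, 1) - n * B (x0, norm x) + s * C (x0, norm x)) *\<^sub>R P x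
      + (A' (0, 1) / norm x - s * D (x0, norm x)) *\<^sub>R (cvec x \<odot> P x)
      + (- norm x * D' (0, 1) - (n + 2) * D (x0, norm x)) *\<^sub>R (P x \<odot> cvec x)
      + (C' (0, 1) / norm x) *\<^sub>R (cvec x \<odot> P x \<odot> cvec x)"
    unfolding axial_two_sided_def Let_def prod.case
    by (rule dirac_left_radial_combination[OF x dr[OF d(1)] dr[OF d(2)] dr[OF d(3)] dr[OF d(4)]])
  have diff: "(\<lambda>y. axial_two_sided A B C D P (x0, y)) differentiable at x"
    if "(A has_derivative A') (at (x0, norm x))" "(B has_derivative B') (at (x0, norm x))"
      "(C has_derivative C') (at (x0, norm x))" "(D has_derivative D') (at (x0, norm x))"
    for A B C D A' B' C' D'
    unfolding axial_two_sided_def Let_def prod.case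
    by (intro differentiable_add radial_differentiable[OF x dr[OF that(1)] P_differentiable]
        radial_differentiable[OF x dr[OF that(2)] differentiable_products(1)]
        radial_differentiable[OF x dr[OF that(3)] differentiable_products(2)]
        radial_differentiable[OF x dr[OF that(4)] differentiable_products(3)])
  \<comment> \<open>Reversal exchanges \<open>xP\<close> with \<open>Px\<close> and fixes the shape
    of \<open>P\<close> and \<open>xPx\<close>, at the cost of the grade sign
    \<open>\<epsilon>\<close>; so the right operator comes from the left one with \<open>B\<close>
    and \<open>C\<close> exchanged.\<close>
  have "crev (axial_two_sided A B C D P (x0, y)) = \<epsilon> *\<^sub>R axial_two_sided A C B D P (x0, y)" for y
    by (simp add: axial_two_sided_def Let_def crev_add crev_scaleR crev_cmul crev_cvec crev_P
        cmul.scaleR_left cmul.scaleR_right cmul_assoc algebra_simps)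
  then have "dirac_right (\<lambda>y. axial_two_sided A B C D P (x0, y)) x =
      crev (\<epsilon> *\<^sub>R dirac_left (\<lambda>y. axial_two_sided A C B D P (x0, y)) x)"
    by (simp add: dirac_right_conv_left[OF diff[OF d]] dirac_left_scaleR[OF diff[OF d(1,3,2,4)]])
  also have "dirac_left (\<lambda>y. axial_two_sided A C B D P (x0, y)) x =
      (- norm x * C' (0, 1) - n * C (x0, norm x) + s * B (x0, norm x)) *\<^sub>R P x
      + (A' (0, 1) / norm x - s * D (x0, norm x)) *\<^sub>R (cvec x \<odot> P x)
      + (- norm x * D' (0, 1) - (n + 2) * D (x0, norm x)) *\<^sub>R (P x \<odot> cvec x)
      + (B' (0, 1) / norm x) *\<^sub>R (cvec x \<odot> P x \<odot> cvec x)"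
    unfolding axial_two_sided_def Let_def prod.case
    by (rule dirac_left_radial_combination[OF x dr[OF d(1)] dr[OF d(3)] dr[OF d(2)] dr[OF d(4)]])
  \<comment> \<open>The outer reversal exchanges the two middle coefficients back and brings a
    second \<open>\<epsilon>\<close>, which cancels the first.\<close>
  also have "crev (\<epsilon> *\<^sub>R (\<alpha> *\<^sub>R P x + \<beta> *\<^sub>R (cvec x \<odot> P x) + \<gamma> *\<^sub>R (P x \<odot> cvec x)
      + \<delta> *\<^sub>R (cvec x \<odot> P x \<odot> cvec x))) =
      (\<epsilon> * \<epsilon>) *\<^sub>R (\<alpha> *\<^sub>R P x + \<gamma> *\<^sub>R (cvec x \<odot> P x) + \<beta> *\<^sub>R (P x \<odot> cvec x)
      + \<delta> *\<^sub>R (cvec x \<odot> P x \<odot> cvec x))" for \<alpha> \<beta> \<gamma> \<delta>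
    by (simp add: crev_add crev_scaleR crev_cmul crev_cvec crev_P
        cmul.scaleR_left cmul.scaleR_right cmul_assoc algebra_simps)
  finally show "dirac_right (\<lambda>y. axial_two_sided A B C D P (x0, y)) x =
      (- norm x * C' (0, 1) - n * C (x0, norm x) + s * B (x0, norm x)) *\<^sub>R P x
      + (- norm x * D' (0, 1) - (n + 2) * D (x0, norm x)) *\<^sub>R (cvec x \<odot> P x)
      + (A' (0, 1) / norm x - s * D (x0, norm x)) *\<^sub>R (P x \<odot> cvec x)
      + (B' (0, 1) / norm x) *\<^sub>R (cvec x \<odot> P x \<odot> cvec x)"
    by (simp only: eps_square scaleR_one)
qed

text \<open>The factor \<open>r\<close> in \<open>N\<close> cancels the denominator of
  \<open>x / r\<close>, and at the origin both vector terms vanish. The formulas for two-sided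
  coefficients thus serve the left axial function too.\<close>

lemma axial_left_eq_two_sided: "axial_left M (\<lambda>p. snd p * H p) P = axial_two_sided M H (\<lambda>_. 0) (\<lambda>_. 0) P"
proof (rule ext, clarify)
  fix x0 :: real and x :: "'m euclid"
  show "axial_left M (\<lambda>p. snd p * H p) P (x0, x) = axial_two_sided M H (\<lambda>_. 0) (\<lambda>_. 0) P (x0, x)"
    by (cases "x = 0") (auto simp: axial_left_def axial_two_sided_def Let_def cmul.add_left cmul.scaleR_left
      cunit_cmul cvec_scaleR cvec_zero cmul.zero_left)
qed

lemma C1_axial_two_sided:
  assumes "C1_on U A" "C1_on U B" "C1_on U C" "C1_on U D"
    and "U \<subseteq> upper_half_plane" and U: "\<And>x0 x. (x0, x) \<in> V \<Longrightarrow> (x0, norm x) \<in> U"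
  shows "C1_on V (axial_two_sided A B C D P)"
proof -
  have x: "snd z \<noteq> 0" if "z \<in> V" for z
    using that assms(5) U[of "fst z" "snd z"] by auto
  have snd: "C1_on V snd" by (rule C1_on_bounded_linear[OF bounded_linear_snd])
  have "C1_on V (\<lambda>z. norm (snd z))"
    by (rule C1_on_compose[OF snd C1_on_norm[of "- {0}"]]) (use x in auto)
  then have rad: "C1_on V (\<lambda>z. (fst z, norm (snd z)))"
    by (intro C1_on_Pair C1_on_bounded_linear[OF bounded_linear_fst])
  have coef: "C1_on V (\<lambda>z. f (fst z, norm (snd z)))" if "C1_on U f" for f :: "real \<times> real \<Rightarrow> real"
    by (rule C1_on_compose[OF rad that]) (use U in auto)
  have xc: "C1_on V (\<lambda>z. cvec (snd z))"
    by (rule C1_on_compose[OF snd C1_on_bounded_linear[OF bounded_linear_cvec, of UNIV]]) simp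
  have Pc: "C1_on V (\<lambda>z. P (snd z))"
    by (rule C1_on_compose[OF snd C1_P[of UNIV]]) simp
  show ?thesis
    unfolding axial_two_sided_def Let_def case_prod_beta
    by (intro C1_on_add bounded_bilinear.C1_on[OF bounded_bilinear_scaleR] bounded_bilinear.C1_on[OF bounded_bilinear_cmul] coef xc Pc assms)
qed

text \<open>\<open>\<bar>s\<bar>\<close> equals \<open>\<bar>m - 2 l\<bar>\<close>, which is below
  \<open>m\<close> because \<open>l\<close> is neither 0 nor \<open>m\<close>.\<close>

lemma abs_s_less:
  assumes "1 \<le> l" "l < CARD('m)"
  shows "\<bar>s\<bar> < n"
  using assms by (auto simp: s_def n_def msign_def abs_mult power_abs)

text \<open>Scalars relating the products on one sphere are the coefficients met at a fixed
  \<open>(x0, r)\<close>. The relation must hold off the sphere before it can be differentiated,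
  whence the rescaling below.\<close>

lemma products_independent:
  assumes sn: "\<bar>s\<bar> < n" and x1: "P x1 \<noteq> 0" and r: "r > 0"
    and eq: "\<And>x. norm x = r \<Longrightarrow> \<alpha> *\<^sub>R P x + \<beta> *\<^sub>R (cvec x \<odot> P x) + \<gamma> *\<^sub>R (P x \<odot> cvec x)
      + \<delta> *\<^sub>R (cvec x \<odot> P x \<odot> cvec x) = 0"
  shows "\<alpha> = 0 \<and> \<beta> = 0 \<and> \<gamma> = 0 \<and> \<delta> = 0"
proof -
  define T where "T x = \<alpha> *\<^sub>R P x + \<delta> *\<^sub>R (cvec x \<odot> P x \<odot> cvec x)" for x
  define S where "S x = \<beta> *\<^sub>R (cvec x \<odot> P x) + \<gamma> *\<^sub>R (P x \<odot> cvec x)" for x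
  have sphere: "T x = 0" "S x = 0" if x: "norm x = r" for x
  proof -
    have neg: "cvec (- x) = - cvec x" "P (- x) = (-1) ^ k *\<^sub>R P x"
      using cvec_scaleR[of "-1" x] P_scaleR[of "-1" x] by auto
    have "T x + S x = 0" using eq[OF x] by (simp add: T_def S_def algebra_simps)
    moreover have "(-1) ^ k *\<^sub>R (T x - S x) = 0"
      using eq[of "- x"] x by (simp add: neg T_def S_def algebra_simps cmul.scaleR_left cmul.scaleR_right
          cmul.minus_left cmul.minus_right)
    then have "T x - S x = 0" by simp
    ultimately have "2 *\<^sub>R T x = 0" "2 *\<^sub>R S x = 0"
      by (simp_all add: scaleR_2)
    then show "T x = 0" "S x = 0" by simp_all
  qed
  have scale: "cvec (t *\<^sub>R x) = t *\<^sub>R cvec x" "P (t *\<^sub>R x) = t ^ k *\<^sub>R P x" for t x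
    by (rule cvec_scaleR, rule P_scaleR)
  have S0: "S x = 0" for x
  proof (cases "x = 0")
    case False
    define t where "t = r / norm x"
    have t: "t > 0" "norm (t *\<^sub>R x) = r" using False r by (auto simp: t_def)
    have "S (t *\<^sub>R x) = t ^ Suc k *\<^sub>R S x"
      by (simp add: S_def scale cmul.scaleR_left cmul.scaleR_right algebra_simps)
    then show ?thesis using sphere(2)[OF t(2)] t(1) by simp
  qed (simp add: S_def cvec_zero cmul.zero_left cmul.zero_right)
  \<comment> \<open>\<open>P\<close> and \<open>xPx\<close> have degrees \<open>k\<close> and
    \<open>k + 2\<close>; the factor \<open>(norm x)\<^sup>2\<close> equalises them, and
    \<open>r\<^sup>2\<close> makes the relation agree with the given one on the sphere, up to a
    scalar.\<close>
  have T0: "((norm x)\<^sup>2 * \<alpha>) *\<^sub>R P x + (r\<^sup>2 * \<delta>) *\<^sub>R (cvec x \<odot> P x \<odot> cvec x) = 0" for x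
  proof (cases "x = 0")
    case False
    define t where "t = r / norm x"
    have t: "t > 0" "norm (t *\<^sub>R x) = r" using False r by (auto simp: t_def)
    have "T (t *\<^sub>R x) = t ^ k *\<^sub>R (\<alpha> *\<^sub>R P x + t\<^sup>2 *\<^sub>R \<delta> *\<^sub>R (cvec x \<odot> P x \<odot> cvec x))"
      by (simp add: T_def scale cmul.scaleR_left cmul.scaleR_right algebra_simps power2_eq_square)
    then have "\<alpha> *\<^sub>R P x + t\<^sup>2 *\<^sub>R \<delta> *\<^sub>R (cvec x \<odot> P x \<odot> cvec x) = 0"
      using sphere(1)[OF t(2)] t(1) by simp
    then have "(norm x)\<^sup>2 *\<^sub>R (\<alpha> *\<^sub>R P x + t\<^sup>2 *\<^sub>R \<delta> *\<^sub>R (cvec x \<odot> P x \<odot> cvec x)) = 0" by simp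
    then show ?thesis using False by (simp add: t_def scaleR_add_right power_divide)
  qed (simp add: cvec_zero cmul.zero_left cmul.zero_right)
  \<comment> \<open>Applying the Dirac operator gives \<open>n \<beta>' = s \<gamma>'\<close>, and
    reversing the relation first gives the same with \<open>\<beta>'\<close> and
    \<open>\<gamma>'\<close> exchanged. The determinant \<open>n^2 - s^2\<close> is nonzero.\<close>
  have mix: "\<beta>' = 0 \<and> \<gamma>' = 0"
    if "\<And>x. x \<noteq> 0 \<Longrightarrow> \<beta>' *\<^sub>R (cvec x \<odot> P x) + \<gamma>' *\<^sub>R (P x \<odot> cvec x) = 0" for \<beta>' \<gamma>'
  proof -
    have lin: "n * \<beta>'' = s * \<gamma>''"
      if 0: "\<And>x. x \<noteq> 0 \<Longrightarrow> \<beta>'' *\<^sub>R (cvec x \<odot> P x) + \<gamma>'' *\<^sub>R (P x \<odot> cvec x) = 0" for \<beta>'' \<gamma>''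
    proof -
      have 0: "(\<lambda>x. \<beta>'' *\<^sub>R (cvec x \<odot> P x) + \<gamma>'' *\<^sub>R (P x \<odot> cvec x)) = (\<lambda>x. 0)"
      proof
        show "\<beta>'' *\<^sub>R (cvec x \<odot> P x) + \<gamma>'' *\<^sub>R (P x \<odot> cvec x) = 0" for x
          by (cases "x = 0") (auto simp: 0 cvec_zero cmul.zero_left cmul.zero_right)
      qed
      have "dirac_left (\<lambda>x. \<beta>'' *\<^sub>R (cvec x \<odot> P x) + \<gamma>'' *\<^sub>R (P x \<odot> cvec x)) x1 =
          \<beta>'' *\<^sub>R (- n *\<^sub>R P x1) + \<gamma>'' *\<^sub>R (s *\<^sub>R P x1)"
        by (subst dirac_left_add) (auto intro!: differentiable_scaleR differentiable_products
            simp: dirac_left_scaleR differentiable_products dirac_xP dirac_Px)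
      then have "(s * \<gamma>'' - n * \<beta>'') *\<^sub>R P x1 = 0"
        unfolding 0 dirac_left_eq[OF has_derivative_const] by (auto simp: cmul.zero_right algebra_simps)
      then show ?thesis using x1 by auto
    qed
    have 1: "n * \<beta>' = s * \<gamma>'" by (rule lin) (rule that)
    have 2: "n * \<gamma>' = s * \<beta>'"
    proof (rule lin)
      fix x :: "'m euclid" assume x: "x \<noteq> 0"
      have "crev (\<epsilon> *\<^sub>R (\<beta>' *\<^sub>R (cvec x \<odot> P x) + \<gamma>' *\<^sub>R (P x \<odot> cvec x))) = 0"
        using that[OF x] crev_scaleR[of 0 0] by simp
      moreover have "crev (\<epsilon> *\<^sub>R (\<beta>' *\<^sub>R (cvec x \<odot> P x) + \<gamma>' *\<^sub>R (P x \<odot> cvec x))) =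
          (\<epsilon> * \<epsilon>) *\<^sub>R (\<gamma>' *\<^sub>R (cvec x \<odot> P x) + \<beta>' *\<^sub>R (P x \<odot> cvec x))"
        by (simp add: crev_add crev_scaleR crev_cmul crev_cvec crev_P
          cmul.scaleR_left cmul.scaleR_right algebra_simps)
      ultimately show "\<gamma>' *\<^sub>R (cvec x \<odot> P x) + \<beta>' *\<^sub>R (P x \<odot> cvec x) = 0"
        by (simp only: eps_square scaleR_one)
    qed
    have "(n - s) * (\<beta>' + \<gamma>') = 0" "(n + s) * (\<beta>' - \<gamma>') = 0"
      using 1 2 by (simp_all add: algebra_simps)
    then have "\<beta>' + \<gamma>' = 0" "\<beta>' - \<gamma>' = 0" using sn by auto
    then show ?thesis by simp
  qed
  have "\<beta> = 0 \<and> \<gamma> = 0" by (rule mix) (use S0 in \<open>simp add: S_def\<close>)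
  \<comment> \<open>The Dirac operator turns the even relation \<open>T0\<close> into one between
    \<open>xP\<close> and \<open>Px\<close>, to which \<open>mix\<close> applies; the
    \<open>2 * \<alpha>\<close> comes from differentiating \<open>(norm x)\<^sup>2\<close>.\<close>
  have "2 * \<alpha> - r\<^sup>2 * \<delta> * s = 0 \<and> - (r\<^sup>2 * \<delta> * (n + 2)) = 0"
  proof (rule mix)
    fix x :: "'m euclid" assume x: "x \<noteq> 0"
    have "((\<lambda>r. r\<^sup>2 * \<alpha>) has_real_derivative 2 * norm x * \<alpha>) (at (norm x))"
      by (auto intro!: derivative_eq_intros)
    note d = this
    have "dirac_left (\<lambda>x. ((norm x)\<^sup>2 * \<alpha>) *\<^sub>R P x + (r\<^sup>2 * \<delta>) *\<^sub>R (cvec x \<odot> P x \<odot> cvec x)) x =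
        (2 * \<alpha>) *\<^sub>R (cvec x \<odot> P x) + (r\<^sup>2 * \<delta>) *\<^sub>R (- (n + 2) *\<^sub>R (P x \<odot> cvec x) - s *\<^sub>R (cvec x \<odot> P x))"
      using x by (subst dirac_left_add) (auto intro!: differentiable_scaleR differentiable_products
          radial_differentiable[OF x d] P_differentiable dirac_left_radial[OF d x P_differentiable, unfolded dirac_P]
          simp: dirac_left_scaleR differentiable_products dirac_xPx dirac_left_radial[OF d x P_differentiable] dirac_P)
    moreover have "dirac_left (\<lambda>x. ((norm x)\<^sup>2 * \<alpha>) *\<^sub>R P x + (r\<^sup>2 * \<delta>) *\<^sub>R (cvec x \<odot> P x \<odot> cvec x)) x = 0"
      unfolding T0 dirac_left_eq[OF has_derivative_const] by (simp add: cmul.zero_right)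
    ultimately show "(2 * \<alpha> - r\<^sup>2 * \<delta> * s) *\<^sub>R (cvec x \<odot> P x) + (- (r\<^sup>2 * \<delta> * (n + 2))) *\<^sub>R (P x \<odot> cvec x) = 0"
      by (simp add: algebra_simps)
  qed
  moreover have "n + 2 \<noteq> 0" using sn by linarith
  ultimately have "\<delta> = 0" "\<alpha> = 0" using r by auto
  with \<open>\<beta> = 0 \<and> \<gamma> = 0\<close> show ?thesis by simp
qed

end

section \<open>Integration of the coefficient equations\<close>

lemma compact_axial_rectangle: "compact (axial_rectangle a1 b1 a2 b2)"
proof (rule compact_eq_bounded_closed[THEN iffD2], intro conjI)
  have "axial_rectangle a1 b1 a2 b2 \<subseteq> {a1..b1} \<times> cball 0 b2"
    by (auto simp: axial_rectangle_def)
  then show "bounded (axial_rectangle a1 b1 a2 b2 :: (real \<times> 'a euclid) set)"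
    by (rule bounded_subset[rotated]) (intro bounded_Times bounded_closed_interval bounded_cball)
  have "axial_rectangle a1 b1 a2 b2 =
      (\<lambda>z. (fst z, norm (snd z :: 'a euclid))) -` ({a1..b1} \<times> {a2..b2})"
    by (auto simp: axial_rectangle_def)
  also have "closed \<dots>"
    by (intro continuous_closed_vimage closed_Times closed_real_atLeastAtMost continuous_intros)
  finally show "closed (axial_rectangle a1 b1 a2 b2 :: (real \<times> 'a euclid) set)" .
qed

text \<open>Compactness gives a uniform margin \<open>e\<close> inside \<open>V\<close>. A point
  over the enlarged rectangle is then close to a point of the original one, although
  \<open>V\<close> itself need not contain whole spheres.\<close>

lemma axial_rectangle_neighbourhood:
  fixes V :: "(real \<times> 'm::finite euclid) set"
  assumes "a1 \<le> b1" "a2 \<le> b2" "a2 > 0" "open V" "axial_rectangle a1 b1 a2 b2 \<subseteq> V"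
  obtains R where "open R" "convex R" "R \<subseteq> upper_half_plane" "{a1..b1} \<times> {a2..b2} \<subseteq> R"
    "\<And>x0 x. (x0, norm x) \<in> R \<Longrightarrow> (x0, x) \<in> V"
proof -
  obtain e where e: "e > 0" "(\<Union>z\<in>axial_rectangle a1 b1 a2 b2. ball z e) \<subseteq> V"
    using compact_subset_open_imp_ball_epsilon_subset[OF compact_axial_rectangle assms(4,5)] by blast
  \<comment> \<open>Half of \<open>e\<close>, since the displacements in \<open>x0\<close> and in
    the radius are added; at most \<open>a2\<close>, so that the open interval of radii stays
    positive.\<close>
  define \<delta> where "\<delta> = min (e / 2) a2"
  have \<delta>: "\<delta> > 0" "\<delta> \<le> e / 2" "\<delta> \<le> a2" using e assms by (auto simp: \<delta>_def)
  show ?thesis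
  proof (rule that[of "{a1 - \<delta> <..< b1 + \<delta>} \<times> {a2 - \<delta> <..< b2 + \<delta>}"])
    fix x0 :: real and x :: "'m euclid"
    assume x: "(x0, norm x) \<in> {a1 - \<delta> <..< b1 + \<delta>} \<times> {a2 - \<delta> <..< b2 + \<delta>}"
    \<comment> \<open>Both coordinates are clamped to the rectangle, and \<open>y\<close> lies on
      the ray of \<open>x\<close>, so that \<open>norm (y - x)\<close> is just the change of
      radius.\<close>
    define t where "t = max a1 (min b1 x0)"
    define \<rho> where "\<rho> = max a2 (min b2 (norm x))"
    define y where "y = (\<rho> / norm x) *\<^sub>R x"
    have "norm x > 0" using x \<delta> by auto
    then have "norm y = \<rho>" using assms by (simp add: y_def \<rho>_def)
    then have "(t, y) \<in> axial_rectangle a1 b1 a2 b2"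
      using assms by (auto simp: axial_rectangle_def t_def \<rho>_def)
    moreover have "dist (t, y) (x0, x) < e"
    proof -
      have "y - x = ((\<rho> - norm x) / norm x) *\<^sub>R x"
        using \<open>norm x > 0\<close> by (simp add: y_def algebra_simps diff_divide_distrib)
      then have "norm (y - x) = \<bar>\<rho> - norm x\<bar>"
        using \<open>norm x > 0\<close> by simp
      moreover have "\<bar>t - x0\<bar> < \<delta>" "\<bar>\<rho> - norm x\<bar> < \<delta>"
        using x \<delta> assms by (auto simp: t_def \<rho>_def)
      moreover have "dist (t, y) (x0, x) \<le> \<bar>t - x0\<bar> + norm (y - x)"
        using norm_Pair_le[of "t - x0" "y - x"] by (simp add: dist_norm)
      ultimately show ?thesis using \<delta> by linarith
    qed
    ultimately show "(x0, x) \<in> V" using e(2) by (meson UN_I mem_ball subsetD)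
  qed (use \<delta> in \<open>auto intro!: open_Times convex_Times\<close>)
qed

context multivector_monogenic
begin

lemma two_sided_coefficient_equations:
  assumes sn: "\<bar>s\<bar> < n" and x1: "P x1 \<noteq> 0" and r: "r > 0"
    and mono: "two_sided_monogenic_on V (axial_two_sided A B C D P)"
    and V: "\<And>x. norm x = r \<Longrightarrow> (x0, x) \<in> V"
    and d: "(A has_derivative A') (at (x0, r))" "(B has_derivative B') (at (x0, r))"
      "(C has_derivative C') (at (x0, r))" "(D has_derivative D') (at (x0, r))"
  shows "B (x0, r) = C (x0, r)"
    and "A' (1, 0) = r * B' (0, 1) + (n - s) * B (x0, r)"
    and "A' (0, 1) = r * (s * D (x0, r) - B' (1, 0))"
    and "B' (1, 0) = r * D' (0, 1) + (n + 2) * D (x0, r)"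
    and "B' (0, 1) = - r * D' (1, 0)"
proof -
  have L: "A' (1, 0) - r * B' (0, 1) - n * B (x0, r) + s * C (x0, r) = 0 \<and>
      B' (1, 0) + A' (0, 1) / r - s * D (x0, r) = 0 \<and>
      C' (1, 0) - r * D' (0, 1) - (n + 2) * D (x0, r) = 0 \<and>
      D' (1, 0) + C' (0, 1) / r = 0"
  proof (rule products_independent[OF sn x1 r])
    fix x :: "'m euclid" assume x: "norm x = r"
    then have x0: "x \<noteq> 0" using r by auto
    have "dx0 (axial_two_sided A B C D P) (x0, x)
        + dirac_left (\<lambda>y. axial_two_sided A B C D P (x0, y)) x = 0"
      using mono V[OF x] by (auto simp: two_sided_monogenic_on_def left_monogenic_on_def)
    then show "(A' (1, 0) - r * B' (0, 1) - n * B (x0, r) + s * C (x0, r)) *\<^sub>R P x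
      + (B' (1, 0) + A' (0, 1) / r - s * D (x0, r)) *\<^sub>R (cvec x \<odot> P x)
      + (C' (1, 0) - r * D' (0, 1) - (n + 2) * D (x0, r)) *\<^sub>R (P x \<odot> cvec x)
      + (D' (1, 0) + C' (0, 1) / r) *\<^sub>R (cvec x \<odot> P x \<odot> cvec x) = 0"
      unfolding dirac_axial_two_sided[OF x0 d[folded x]] x by (simp add: algebra_simps)
  qed
  have R: "A' (1, 0) - r * C' (0, 1) - n * C (x0, r) + s * B (x0, r) = 0 \<and>
      B' (1, 0) - r * D' (0, 1) - (n + 2) * D (x0, r) = 0 \<and>
      C' (1, 0) + A' (0, 1) / r - s * D (x0, r) = 0 \<and>
      D' (1, 0) + B' (0, 1) / r = 0"
  proof (rule products_independent[OF sn x1 r])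
    fix x :: "'m euclid" assume x: "norm x = r"
    then have x0: "x \<noteq> 0" using r by auto
    have "dx0 (axial_two_sided A B C D P) (x0, x)
        + dirac_right (\<lambda>y. axial_two_sided A B C D P (x0, y)) x = 0"
      using mono V[OF x] by (auto simp: two_sided_monogenic_on_def right_monogenic_on_def)
    then show "(A' (1, 0) - r * C' (0, 1) - n * C (x0, r) + s * B (x0, r)) *\<^sub>R P x
      + (B' (1, 0) - r * D' (0, 1) - (n + 2) * D (x0, r)) *\<^sub>R (cvec x \<odot> P x)
      + (C' (1, 0) + A' (0, 1) / r - s * D (x0, r)) *\<^sub>R (P x \<odot> cvec x)
      + (D' (1, 0) + B' (0, 1) / r) *\<^sub>R (cvec x \<odot> P x \<odot> cvec x) = 0"
      unfolding dirac_axial_two_sided[OF x0 d[folded x]] x by (simp add: algebra_simps)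
  qed
  \<comment> \<open>The \<open>xPx\<close> coefficients equate the radial derivatives of
    \<open>B\<close> and \<open>C\<close>. Subtracting the two \<open>P\<close> coefficients then
    leaves the purely algebraic \<open>(n + s) (B - C) = 0\<close>.\<close>
  have "B' (0, 1) / r = C' (0, 1) / r" using L R by linarith
  then have BC': "B' (0, 1) = C' (0, 1)" using r by simp
  then have "(n + s) * (B (x0, r) - C (x0, r)) = 0" using L R by (simp add: algebra_simps)
  then show BC: "B (x0, r) = C (x0, r)" using sn by auto
  show "A' (1, 0) = r * B' (0, 1) + (n - s) * B (x0, r)" using L BC by (simp add: algebra_simps)
  have "A' (0, 1) / r = s * D (x0, r) - B' (1, 0)" using L by linarith
  then show "A' (0, 1) = r * (s * D (x0, r) - B' (1, 0))" using r by (simp add: field_simps)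
  show "B' (1, 0) = r * D' (0, 1) + (n + 2) * D (x0, r)" using R by linarith
  have "B' (0, 1) / r = - D' (1, 0)" using R by linarith
  then show "B' (0, 1) = - r * D' (1, 0)" using r by (simp add: field_simps)
qed

end

section \<open>Construction of the axial left monogenic function\<close>

theorem theorem6:
  fixes k l :: nat
    and a1 b1 a2 b2 :: real
    and P :: "'m::{finite,linorder} euclid \<Rightarrow> 'm clifford"
    and A B C D :: "real \<times> real \<Rightarrow> real"
    and V :: "(real \<times> 'm euclid) set"
  assumes "CARD('m) \<ge> 2" and "1 \<le> l" and "l \<le> CARD('m) - 1"
    and "P \<in> left_monogenic_polys k" and "\<And>x. P x \<in> multivectors l"
    and "a2 > 0"
    and "open V" and "axial_rectangle a1 b1 a2 b2 \<subseteq> V"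
    and "axial_two_sided_monogenic_on V k l A B C D P"
  shows "\<exists>W M N. open W \<and> axial_rectangle a1 b1 a2 b2 \<subseteq> W \<and>
           axial_left_monogenic_on W k M N P \<and>
           (\<exists>c::real. \<forall>(x0, x)\<in>axial_rectangle a1 b1 a2 b2.
              axial_two_sided A B C D P (x0, x) - conj_CR_right (axial_left M N P) (x0, x)
                = c *\<^sub>R P x)"
proof -
  obtain U where U: "open U" "U \<subseteq> upper_half_plane" "\<forall>(x0, x)\<in>V. (x0, norm x) \<in> U"
      "C1_on U A" "C1_on U B" "C1_on U C" "C1_on U D"
    and mono: "two_sided_monogenic_on V (axial_two_sided A B C D P)"
    using assms(9) unfolding axial_two_sided_monogenic_on_def by blast
  consider "\<not> (a1 \<le> b1 \<and> a2 \<le> b2)" | "\<And>x. P x = 0" | x1 where "a1 \<le> b1" "a2 \<le> b2" "P x1 \<noteq> 0"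
    by blast
  then show ?thesis
  proof cases
    case 1
    then have "axial_rectangle a1 b1 a2 b2 = ({} :: (real \<times> 'm euclid) set)"
      by (auto simp: axial_rectangle_def)
    moreover have "axial_left_monogenic_on {} k (\<lambda>_. 0) (\<lambda>_. 0) P"
      using assms(4) by (auto simp: axial_left_monogenic_on_def left_monogenic_on_def C1_on_def intro!: exI[of _ "{}"])
    ultimately show ?thesis by (intro exI[of _ "{}"]) auto
  next
    case 2
    \<comment> \<open>The axis is removed because \<open>(x0, norm x)\<close> has to lie in the open
      half plane.\<close>
    define W where "W = {z :: real \<times> 'm euclid. 0 < norm (snd z)}"
    have "open W" unfolding W_def by (intro open_Collect_less continuous_intros)
    have zero: "axial_left (\<lambda>_. 0) (\<lambda>_. 0) P = (\<lambda>_. 0)" "axial_two_sided A B C D P = (\<lambda>_. 0)"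
      using 2 by (auto simp: fun_eq_iff axial_left_def axial_two_sided_def Let_def cmul.zero_left cmul.zero_right)
    have dirac: "dirac_left (\<lambda>_. 0) x = 0" "dirac_right (\<lambda>_. 0) x = 0" for x :: "'m euclid"
      by (simp_all add: dirac_left_eq[OF has_derivative_const] dirac_right_eq[OF has_derivative_const]
          cmul.zero_right cmul.zero_left)
    have "open upper_half_plane"
      unfolding case_prod_beta by (intro open_Collect_less continuous_intros)
    then have "axial_left_monogenic_on W k (\<lambda>_. 0) (\<lambda>_. 0) P"
      using assms(4) unfolding axial_left_monogenic_on_def left_monogenic_on_def zero
      by (auto simp: W_def C1_on_const dirac dx0_def intro!: exI[of _ upper_half_plane])
    moreover have "axial_rectangle a1 b1 a2 b2 \<subseteq> W"
      using assms(6) by (auto simp: W_def axial_rectangle_def)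
    moreover have "\<forall>(x0, x)\<in>axial_rectangle a1 b1 a2 b2.
        axial_two_sided A B C D P (x0, x) - conj_CR_right (axial_left (\<lambda>_. 0) (\<lambda>_. 0) P) (x0, x) = 0 *\<^sub>R P x"
      unfolding zero by (auto simp: conj_CR_right_def dx0_def dirac)
    ultimately show ?thesis using \<open>open W\<close> by blast
  next
    case (3 x1)
    define n where "n = real CARD('m) + 2 * real k"
    define s where "s = msign CARD('m) l"
    interpret multivector_monogenic k l n s P
      by unfold_locales (use assms in \<open>auto simp: n_def s_def\<close>)
    have sn: "\<bar>s\<bar> < n" by (rule abs_s_less) (use assms in auto)
    obtain R where R: "open R" "convex R" "R \<subseteq> upper_half_plane" "{a1..b1} \<times> {a2..b2} \<subseteq> R"
      "\<And>x0 x. (x0, norm x) \<in> R \<Longrightarrow> (x0, x :: 'm euclid) \<in> V"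
      by (rule axial_rectangle_neighbourhood[OF 3(1,2) assms(6,7,8)]) blast
    \<comment> \<open>\<open>W\<close> consists of all points over \<open>R\<close>; unlike
      \<open>V\<close> it is rotation invariant, and \<open>H\<close> and \<open>M\<close> are
      available at each of its points.\<close>
    define W where "W = (\<lambda>z. (fst z, norm (snd z :: 'm euclid))) -` R"
    have "open W"
      unfolding W_def by (intro continuous_open_vimage R continuous_intros)
    have KW: "axial_rectangle a1 b1 a2 b2 \<subseteq> W"
      by (auto simp: W_def axial_rectangle_def intro!: subsetD[OF R(4)])
    have RU: "R \<subseteq> U"
    proof
      fix p assume p: "p \<in> R"
      \<comment> \<open>Every point of \<open>R\<close> is attained by some vector of length
        \<open>snd p\<close>; \<open>undefined\<close> is an arbitrary coordinate index.\<close>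
      define x :: "'m euclid" where "x = snd p *\<^sub>R axis undefined 1"
      have "norm x = snd p" using p R(3) by (auto simp: x_def)
      then show "p \<in> U" using R(5)[of "fst p" x] U(3) p by fastforce
    qed
    have R0: "snd p > 0" if "p \<in> R" for p using that R(3) by auto
    note C1 = U(4-7)[THEN C1_on_subset[OF _ RU]]
    obtain A' where A': "\<And>p. p \<in> R \<Longrightarrow> (A has_derivative A' p) (at p)"
      "\<And>h. continuous_on R (\<lambda>p. A' p h)" by (rule C1_onE[OF C1(1)]) blast
    obtain B' where B': "\<And>p. p \<in> R \<Longrightarrow> (B has_derivative B' p) (at p)"
      "\<And>h. continuous_on R (\<lambda>p. B' p h)" by (rule C1_onE[OF C1(2)]) blast
    obtain C' where C': "\<And>p. p \<in> R \<Longrightarrow> (C has_derivative C' p) (at p)"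
      "\<And>h. continuous_on R (\<lambda>p. C' p h)" by (rule C1_onE[OF C1(3)]) blast
    obtain D' where D': "\<And>p. p \<in> R \<Longrightarrow> (D has_derivative D' p) (at p)"
      "\<And>h. continuous_on R (\<lambda>p. D' p h)" by (rule C1_onE[OF C1(4)]) blast
    have eqs: "B p = C p" "A' p (1, 0) = snd p * B' p (0, 1) + (n - s) * B p"
      "A' p (0, 1) = snd p * (s * D p - B' p (1, 0))"
      "B' p (1, 0) = snd p * D' p (0, 1) + (n + 2) * D p"
      "B' p (0, 1) = - snd p * D' p (1, 0)" if p: "p \<in> R" for p
      using two_sided_coefficient_equations[OF sn 3(3) R0[OF p] mono, where ?x0.0 = "fst p"
          and A' = "A' p" and B' = "B' p" and C' = "C' p" and D' = "D' p"]
        R(5) A'(1)[OF p] B'(1)[OF p] C'(1)[OF p] D'(1)[OF p] p by auto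
    note cont = C1[THEN C1_on_imp_continuous_on]

    \<comment> \<open>The radial part of \<open>dH\<close>, read off from the \<open>xPx\<close>
      coefficient \<open>- H_r / r\<close>, which has to equal \<open>D\<close>. The form is closed
      by \<open>B_r = - r D_0\<close>.\<close>
    define g where "g p = - snd p * D p" for p
    obtain H where H: "\<And>p. p \<in> R \<Longrightarrow> (H has_derivative (\<lambda>h. B p * fst h + g p * snd h)) (at p)"
    proof (rule closed_form_exact_plane[OF R(1,2) B', where g = g and g' = "\<lambda>p h. - (snd h * D p + snd p * D' p h)"])
      show "(g has_derivative (\<lambda>h. - (snd h * D p + snd p * D' p h))) (at p)" if "p \<in> R" for p
        unfolding g_def by (auto intro!: derivative_eq_intros D' that)
      show "continuous_on R (\<lambda>p. - (snd h * D p + snd p * D' p h))" for h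
        by (intro continuous_intros cont D')
      show "B' p (0, 1) = - (snd (1::real, 0) * D p + snd p * D' p (1, 0))" if "p \<in> R" for p
        using eqs(5)[OF that] by simp
    qed blast+
    have C1_H: "C1_on R H"
      by (rule C1_onI[OF H]) (auto simp: g_def intro!: continuous_intros cont)

    \<comment> \<open>The value of \<open>M_0\<close> forced by left monogenicity, with
      \<open>H_r = - r D\<close> inserted. Closedness of \<open>dM\<close> is the equation
      \<open>B_0 = r D_r + (n + 2) D\<close>.\<close>
    define f where "f p = - (snd p)\<^sup>2 * D p + n * H p" for p
    obtain M where M: "\<And>p. p \<in> R \<Longrightarrow> (M has_derivative (\<lambda>h. f p * fst h + (- snd p * B p) * snd h)) (at p)"
    proof (rule closed_form_exact_plane[OF R(1,2),
        where f = f and f' = "\<lambda>p h. - (2 * snd p * snd h * D p + (snd p)\<^sup>2 * D' p h) + n * (B p * fst h + g p * snd h)"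
          and g = "\<lambda>p. - snd p * B p" and g' = "\<lambda>p h. - (snd h * B p + snd p * B' p h)"])
      show "(f has_derivative (\<lambda>h. - (2 * snd p * snd h * D p + (snd p)\<^sup>2 * D' p h)
          + n * (B p * fst h + g p * snd h))) (at p)" if "p \<in> R" for p
        unfolding f_def by (auto intro!: derivative_eq_intros D' H that simp: algebra_simps)
      show "continuous_on R (\<lambda>p. - (2 * snd p * snd h * D p + (snd p)\<^sup>2 * D' p h)
          + n * (B p * fst h + g p * snd h))" for h
        unfolding g_def by (intro continuous_intros cont D')
      show "((\<lambda>p. - snd p * B p) has_derivative (\<lambda>h. - (snd h * B p + snd p * B' p h))) (at p)"
        if "p \<in> R" for p
        by (auto intro!: derivative_eq_intros B' that)
      show "continuous_on R (\<lambda>p. - (snd h * B p + snd p * B' p h))" for h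
        by (intro continuous_intros cont B')
      show "- (2 * snd p * snd (0::real, 1) * D p + (snd p)\<^sup>2 * D' p (0, 1))
          + n * (B p * fst (0::real, 1::real) + g p * snd (0::real, 1)) =
          - (snd (1::real, 0) * B p + snd p * B' p (1, 0))" if "p \<in> R" for p
        by (simp add: eqs(4)[OF that] g_def algebra_simps power2_eq_square)
    qed blast+
    have C1_M: "C1_on R M"
      by (rule C1_onI[OF M])
        (auto simp: f_def intro!: continuous_intros cont C1_on_imp_continuous_on[OF C1_H])

    have zero: "((\<lambda>_. 0) has_derivative (\<lambda>_. 0)) (at p)" for p :: "real \<times> real"
      by (rule has_derivative_const)
    let ?N = "\<lambda>p. snd p * H p"
    have C1_G: "C1_on W (axial_left M ?N P)"
      unfolding axial_left_eq_two_sided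
      by (rule C1_axial_two_sided[OF C1_M C1_H C1_on_const C1_on_const R(3)]) (auto simp: W_def)
    have "left_monogenic_on W (axial_left M ?N P)"
      unfolding left_monogenic_on_def
    proof (intro conjI C1_G, clarify)
      fix x0 :: real and x :: "'m euclid" assume "(x0, x) \<in> W"
      then have p: "(x0, norm x) \<in> R" by (simp add: W_def)
      then have x: "x \<noteq> 0" using R0 by fastforce
      show "dx0 (axial_left M ?N P) (x0, x) + dirac_left (\<lambda>y. axial_left M ?N P (x0, y)) x = 0"
        using x unfolding axial_left_eq_two_sided dirac_axial_two_sided[OF x M[OF p] H[OF p] zero zero]
        by (simp add: f_def g_def algebra_simps power2_eq_square)
    qed
    moreover have "C1_on R ?N"
      by (intro bounded_bilinear.C1_on[OF bounded_bilinear_mult] C1_on_bounded_linear bounded_linear_snd C1_H)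
    ultimately have "axial_left_monogenic_on W k M ?N P"
      using assms(4) R(1,3) C1_M unfolding axial_left_monogenic_on_def
      by (intro conjI exI[of _ R]) (auto simp: W_def)

    define c where "c p = A p + (snd p)\<^sup>2 * D p - (n - s) * H p" for p
    have "(c has_derivative (\<lambda>h. 0)) (at p within R)" if p: "p \<in> R" for p
    proof -
      have "(c has_derivative (\<lambda>h. A' p h + (2 * snd p * snd h * D p + (snd p)\<^sup>2 * D' p h)
          - (n - s) * (B p * fst h + g p * snd h))) (at p)"
        unfolding c_def by (auto intro!: derivative_eq_intros A' D' H p simp: algebra_simps)
      \<comment> \<open>In the \<open>x0\<close> direction the equation for \<open>A_0\<close>
        leaves \<open>r (B_r + r D_0)\<close>; in the radial direction the one for
        \<open>A_r\<close> leaves \<open>r (r D_r + (n + 2) D - B_0)\<close>. Both vanish by the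
        conditions that make the forms closed.\<close>
      moreover have "A' p h + (2 * snd p * snd h * D p + (snd p)\<^sup>2 * D' p h)
          - (n - s) * (B p * fst h + g p * snd h) = 0" for h
      proof -
        have "A' p h = fst h * A' p (1, 0) + snd h * A' p (0, 1)"
          "D' p h = fst h * D' p (1, 0) + snd h * D' p (0, 1)"
          by (rule linear_plane[OF has_derivative_linear], rule A'(1)[OF p])
             (rule linear_plane[OF has_derivative_linear], rule D'(1)[OF p])
        then show ?thesis
          by (simp add: eqs(2-5)[OF p] g_def algebra_simps power2_eq_square)
      qed
      ultimately show ?thesis by (simp add: has_derivative_at_withinI)
    qed
    from has_derivative_zero_constant[OF R(2) this] obtain c0 where c0: "\<forall>p\<in>R. c p = c0" by blast

    have "axial_two_sided A B C D P (x0, x) - conj_CR_right (axial_left M ?N P) (x0, x) = c0 *\<^sub>R P x"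
      if "(x0, x) \<in> axial_rectangle a1 b1 a2 b2" for x0 x
    proof -
      have p: "(x0, norm x) \<in> R" using KW that by (auto simp: W_def)
      then have x: "x \<noteq> 0" using R0 by fastforce
      have "conj_CR_right (axial_left M ?N P) (x0, x) = (f (x0, norm x) - s * H (x0, norm x)) *\<^sub>R P x
          + B (x0, norm x) *\<^sub>R (cvec x \<odot> P x) + B (x0, norm x) *\<^sub>R (P x \<odot> cvec x)
          + D (x0, norm x) *\<^sub>R (cvec x \<odot> P x \<odot> cvec x)"
        using x unfolding axial_left_eq_two_sided conj_CR_right_def prod.case
          dirac_axial_two_sided[OF x M[OF p] H[OF p] zero zero]
        by (simp add: g_def algebra_simps)
      moreover have "axial_two_sided A B C D P (x0, x) = A (x0, norm x) *\<^sub>R P x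
          + B (x0, norm x) *\<^sub>R (cvec x \<odot> P x) + B (x0, norm x) *\<^sub>R (P x \<odot> cvec x)
          + D (x0, norm x) *\<^sub>R (cvec x \<odot> P x \<odot> cvec x)"
        by (simp add: axial_two_sided_def Let_def eqs(1)[OF p])
      ultimately have "axial_two_sided A B C D P (x0, x) - conj_CR_right (axial_left M ?N P) (x0, x) =
          c (x0, norm x) *\<^sub>R P x"
        by (simp add: c_def f_def algebra_simps)
      then show ?thesis using c0 p by simp
    qed
    then show ?thesis
      using \<open>open W\<close> KW \<open>axial_left_monogenic_on W k M ?N P\<close> by (intro exI[of _ W] exI[of _ M] exI[of _ ?N]) auto
  qed
qed

end
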